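(* Let $\beta_0=(\beta_{x,0},\beta_{y,0})$ be a pair of positive reals, let $b,t$ be reals, and for $k\in\mathbb N$ let $$\theta_k=\frac{t}{k+t},\quad \beta_k=(\beta_{x,k},\beta_{y,k})=\frac{b}{k+b}\beta_0,\quad \gamma_{x,k}=\frac{\beta_{y,k}}{2\beta_{x,k}\beta_{y,k}+\|A\|^2},\quad \gamma_{y,k}=\frac{\beta_{x,k}}{2\beta_{y,k}\beta_{x,k}+\|A\|^2}.$$ Suppose that $$b\ge t\ge2,\qquad \bar c=\frac{\beta_{x,0}\beta_{y,0}b^2}{t\|M\|^2}<1 .$$ Let $\bar z_0=z_0\in\mathcal Z$ and, for $k\in\mathbb N$, $$\hat z_k=(1-\theta_k)z_k+\theta_k\bar z_k,\qquad \bar z_{k+1}=\operatorname{prox}_{\frac{\gamma_k}{\theta_k},F}\Big(\bar z_k-\frac{\gamma_k}{\theta_k}.\nabla F^*_{\beta_k,M}(\hat z_k)\Big),\qquad z_{k+1}=(1-\theta_k)z_k+\theta_k\bar z_{k+1}.$$ Then for every $z^*\in\mathcal Z_*$ and all $K\ge1$, $$G_{\beta_K}(z_K)\le\frac b2\,\frac{1}{(K+b-2)^{1-\bar c}}\,\|z_0-z^*\|^2_{\gamma_0^{-1}+\beta_0}\in O(K^{\bar c-1}).$$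
   Context: Let $\mathcal X=\mathbb R^n$, $\mathcal Y=\mathbb R^m$, $\mathcal Z=\mathcal X\times\mathcal Y$ with the Euclidean inner product. Let $f:\mathcal X\to\mathbb R\cup\{+\infty\}$ and $g:\mathcal Y\to\mathbb R\cup\{+\infty\}$ be proper lower semicontinuous convex functions, $g^*$ the Fenchel conjugate of $g$, and $A:\mathcal X\to\mathcal Y$ a nonzero linear operator. It is assumed that the set $\mathcal Z_*$ of saddle points of $\min_x\max_y f(x)+\langle Ax,y\rangle-g^*(y)$ is not empty. For $z=(x,y)\in\mathcal Z$ put $F(z)=f(x)+g^*(y)$ and $Mz=(-A^\top y,Ax)$; $\|M\|=\|A\|$ is the operator norm. For a pair $\beta=(\beta_x,\beta_y)$ of positive reals: $\beta.z=(\beta_xx,\beta_yy)$, $\|z\|_\beta^2=\beta_x\|x\|^2+\beta_y\|y\|^2$, $\beta^{-1}=(\beta_x^{-1},\beta_y^{-1})$; sums and scalar multiples of pairs are componentwise, so $\gamma_0^{-1}+\beta_0=(\gamma_{x,0}^{-1}+\beta_{x,0},\gamma_{y,0}^{-1}+\beta_{y,0})$. Define $$F^*_{\beta,M}(z)=\sup_{z'\in\mathcal Z}\ \langle Mz,z'\rangle-F(z')-\frac12\|z-z'\|_\beta^2,\qquad G_\beta(z)=F(z)+F^*_{\beta,M}(z).$$ $G_\beta$ is called the self-centered smoothed duality gap. The function $F^*_{\beta,M}$ is differentiable with $\nabla F^*_{\beta,M}(z)=-M\bar z_\beta(z)+\beta.(\bar z_\beta(z)-z)$, where $\bar z_\beta(z)=\arg\min_{z'}F(z')-\langle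 Mz,z'\rangle+\frac12\|z'-z\|_\beta^2$. For a pair $\tau$ of positive reals, $\operatorname{prox}_{\tau,F}(w)=\arg\min_{z'}F(z')+\frac12\|z'-w\|_{\tau^{-1}}^2$. *)

theory Defs
  imports "HOL-Analysis.Analysis" "HOL-Library.Landau_Symbols"
begin

definition proper_fun :: "('a \<Rightarrow> ereal) \<Rightarrow> bool" where
  "proper_fun f \<longleftrightarrow> (\<forall>x. f x \<noteq> -\<infinity>) \<and> (\<exists>x. f x \<noteq> \<infinity>)"

definition lsc_fun :: "('a::topological_space \<Rightarrow> ereal) \<Rightarrow> bool" where
  "lsc_fun f \<longleftrightarrow> (\<forall>x. f x \<le> Liminf (at x) f)"

definition convex_fun :: "('a::real_vector \<Rightarrow> ereal) \<Rightarrow> bool" where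
  "convex_fun f \<longleftrightarrow> convex {(x, r::real). f x \<le> ereal r}"

definition fenchel_conj :: "('a::real_inner \<Rightarrow> ereal) \<Rightarrow> 'a \<Rightarrow> ereal" where
  "fenchel_conj g y = (SUP v. ereal (v \<bullet> y) - g v)"

definition gradient :: "('a::real_inner \<Rightarrow> real) \<Rightarrow> 'a \<Rightarrow> 'a" where
  "gradient h z = (THE D. GDERIV h z :> D)"

text \<open>
  Since \<open>\<infinity> - \<infinity> = \<infinity>\<close> on \<open>ereal\<close>, the Lagrangian takes the
  value \<open>\<infinity>\<close> whenever \<open>f x = \<infinity>\<close>. This choice is immaterial for saddle points:
  if \<open>f\<close> and \<open>fenchel_conj g\<close> are proper, both are finite at every saddle point, so
  \<open>\<infinity> - \<infinity>\<close> does not occur in the two inequalities.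
\<close>

definition lagrangian ::
  "('a::real_inner \<Rightarrow> ereal) \<Rightarrow> ('b::real_inner \<Rightarrow> ereal) \<Rightarrow> ('a \<Rightarrow> 'b) \<Rightarrow> 'a \<Rightarrow> 'b \<Rightarrow> ereal" where
  "lagrangian f g A x y = f x + ereal (A x \<bullet> y) - fenchel_conj g y"

definition saddle_points ::
  "('a::real_inner \<Rightarrow> ereal) \<Rightarrow> ('b::real_inner \<Rightarrow> ereal) \<Rightarrow> ('a \<Rightarrow> 'b) \<Rightarrow> ('a \<times> 'b) set" where
  "saddle_points f g A = {(xs, ys).
     (\<forall>y. lagrangian f g A xs y \<le> lagrangian f g A xs ys) \<and>
     (\<forall>x. lagrangian f g A xs ys \<le> lagrangian f g A x ys)}"

definition sum_fun ::
  "('a::real_inner \<Rightarrow> ereal) \<Rightarrow> ('b::real_inner \<Rightarrow> ereal) \<Rightarrow> 'a \<times> 'b \<Rightarrow> ereal" where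
  "sum_fun f g z = f (fst z) + fenchel_conj g (snd z)"

definition skew_op :: "('a::real_inner \<Rightarrow> 'b::real_inner) \<Rightarrow> 'a \<times> 'b \<Rightarrow> 'a \<times> 'b" where
  "skew_op A z = (- adjoint A (snd z), A (fst z))"

text \<open>
  Pairs of weights are elements of \<open>real \<times> real\<close>; their sums and scalar multiples are those
  of the product vector space.
\<close>

definition pair_inverse :: "real \<times> real \<Rightarrow> real \<times> real" where
  "pair_inverse \<beta> = (1 / fst \<beta>, 1 / snd \<beta>)"

definition pair_scale ::
  "real \<times> real \<Rightarrow> 'a::real_vector \<times> 'b::real_vector \<Rightarrow> 'a \<times> 'b" where
  "pair_scale \<beta> z = (fst \<beta> *\<^sub>R fst z, snd \<beta> *\<^sub>R snd z)"

definition wnorm_sq :: "real \<times> real \<Rightarrow> 'a::real_inner \<times> 'b::real_inner \<Rightarrow> real" where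
  "wnorm_sq \<beta> z = fst \<beta> * (norm (fst z))\<^sup>2 + snd \<beta> * (norm (snd z))\<^sup>2"

definition smoothed_conj ::
  "real \<times> real \<Rightarrow> ('a::real_inner \<times> 'b::real_inner \<Rightarrow> 'a \<times> 'b) \<Rightarrow> ('a \<times> 'b \<Rightarrow> ereal)
     \<Rightarrow> 'a \<times> 'b \<Rightarrow> ereal" where
  "smoothed_conj \<beta> M F z = (SUP z'. ereal (M z \<bullet> z') - F z' - ereal (1 / 2 * wnorm_sq \<beta> (z - z')))"

definition smoothed_gap ::
  "real \<times> real \<Rightarrow> ('a::real_inner \<times> 'b::real_inner \<Rightarrow> 'a \<times> 'b) \<Rightarrow> ('a \<times> 'b \<Rightarrow> ereal)
     \<Rightarrow> 'a \<times> 'b \<Rightarrow> ereal" where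
  "smoothed_gap \<beta> M F z = F z + smoothed_conj \<beta> M F z"

text \<open>
  For the functions considered here \<open>smoothed_conj\<close> is finite everywhere, so that the
  conversion to \<open>real\<close> loses nothing.
\<close>

definition grad_smoothed_conj ::
  "real \<times> real \<Rightarrow> ('a::real_inner \<times> 'b::real_inner \<Rightarrow> 'a \<times> 'b) \<Rightarrow> ('a \<times> 'b \<Rightarrow> ereal)
     \<Rightarrow> 'a \<times> 'b \<Rightarrow> 'a \<times> 'b" where
  "grad_smoothed_conj \<beta> M F = gradient (\<lambda>z. real_of_ereal (smoothed_conj \<beta> M F z))"

definition prox ::
  "real \<times> real \<Rightarrow> ('a::real_inner \<times> 'b::real_inner \<Rightarrow> ereal) \<Rightarrow> 'a \<times> 'b \<Rightarrow> 'a \<times> 'b" where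
  "prox \<tau> F w = (ARG_MIN (\<lambda>z'. F z' + ereal (1 / 2 * wnorm_sq (pair_inverse \<tau>) (z' - w))) z'. True)"

end

theory Submission
  imports Defs
begin

text \<open>
  Fix a saddle point \<open>z\<^sup>*\<close> and put \<open>N = \<parallel>A\<parallel>\<^sup>2 (1 / \<beta>\<^sub>y\<^sub>,\<^sub>0, 1 / \<beta>\<^sub>x\<^sub>,\<^sub>0)\<close>, \<open>s\<^sub>k = b / (k + b)\<close>. The weights
  \<open>\<beta>\<^sub>k\<close> and \<open>\<gamma>\<^sub>k\<^sup>-\<^sup>1\<close> are scalar multiples of \<open>N\<close>, namely \<open>\<epsilon>\<^sub>k / s\<^sub>k\<close> and \<open>(1 + 2 \<epsilon>\<^sub>k) / s\<^sub>k\<close> times \<open>N\<close>,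
  where \<open>\<epsilon>\<^sub>k = \<beta>\<^sub>x\<^sub>,\<^sub>0 \<beta>\<^sub>y\<^sub>,\<^sub>0 s\<^sub>k\<^sup>2 / \<parallel>A\<parallel>\<^sup>2\<close>. Although \<open>F\<^sup>*\<^sub>\<beta>\<^sub>,\<^sub>M\<close> is not convex, its linearisation error lies
  between \<open>- 1/2 \<parallel>d\<parallel>\<^sub>\<beta>\<^sup>2\<close> and \<open>1/2 \<parallel>M d\<parallel>\<^sup>2\<close> in the norm of \<open>\<beta>\<^sup>-\<^sup>1\<close>. The usual estimate for an accelerated
  proximal gradient step therefore holds up to the error
  \<open>1/2 \<theta>\<^sub>k (1 - \<theta>\<^sub>k) \<parallel>z\<^sub>k - z\<^sup>*\<parallel>\<^sup>2 + 1/2 \<theta>\<^sub>k\<^sup>2 \<parallel>zbar\<^sub>k - z\<^sup>*\<parallel>\<^sup>2\<close> in the norm of \<open>\<beta>\<^sub>k\<close>. Convexity of \<open>F\<close> makes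
  \<open>\<rho> \<mapsto> \<rho> G\<^bsub>\<rho>\<beta>\<^esub>(z)\<close> nondecreasing, so that passing from \<open>\<beta>\<^sub>k\<close> to \<open>\<beta>\<^bsub>k+1\<^esub>\<close> costs only the factor
  \<open>s\<^sub>k / s\<^bsub>k+1\<^esub>\<close>. After division by \<open>\<theta>\<^sub>k\<^sup>2\<close> the error terms multiply the Lyapunov function by at most
  \<open>1 + cbar / (k + b)\<close>, and the product of these factors is at most \<open>((K - 1 + b) / b)\<^bsup>cbar\<^esup>\<close>.
\<close>

subsection \<open>Weighted norms\<close>

lemma wnorm_sq_eq: "wnorm_sq a u = pair_scale a u \<bullet> u"
  by (simp add: wnorm_sq_def pair_scale_def inner_prod_def power2_norm_eq_inner)

lemma pair_scale_commute: "pair_scale a u \<bullet> v = pair_scale a v \<bullet> u"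
  by (simp add: pair_scale_def inner_prod_def inner_commute)

lemma pair_scale_add: "pair_scale a (u + v) = pair_scale a u + pair_scale a v"
  by (simp add: pair_scale_def scaleR_add_right)

lemma pair_scale_diff: "pair_scale a (u - v) = pair_scale a u - pair_scale a v"
  by (simp add: pair_scale_def scaleR_diff_right)

lemma pair_scale_scaleR: "pair_scale a (r *\<^sub>R u) = r *\<^sub>R pair_scale a u"
  by (simp add: pair_scale_def)

lemma wnorm_sq_add:
  "wnorm_sq a (u + v) = wnorm_sq a u + 2 * (pair_scale a u \<bullet> v) + wnorm_sq a v"
  using pair_scale_commute[of a v u]
  by (simp add: wnorm_sq_eq pair_scale_add inner_add_left inner_add_right)

lemma wnorm_sq_diff:
  "wnorm_sq a (u - v) = wnorm_sq a u - 2 * (pair_scale a u \<bullet> v) + wnorm_sq a v"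
  using pair_scale_commute[of a v u]
  by (simp add: wnorm_sq_eq pair_scale_diff inner_diff_left inner_diff_right)

lemma wnorm_sq_minus_commute: "wnorm_sq a (u - v) = wnorm_sq a (v - u)"
  by (simp add: wnorm_sq_def norm_minus_commute)

lemma wnorm_sq_scaleR: "wnorm_sq a (r *\<^sub>R u) = r\<^sup>2 * wnorm_sq a u"
  by (simp add: wnorm_sq_eq pair_scale_scaleR power2_eq_square)

lemma wnorm_sq_weight_add: "wnorm_sq (a + b) u = wnorm_sq a u + wnorm_sq b u"
  by (simp add: wnorm_sq_def algebra_simps)

lemma wnorm_sq_weight_scaleR: "wnorm_sq (r *\<^sub>R a) u = r * wnorm_sq a u"
  by (simp add: wnorm_sq_def algebra_simps)

lemma wnorm_sq_nonneg: "0 \<le> fst a \<Longrightarrow> 0 \<le> snd a \<Longrightarrow> 0 \<le> wnorm_sq a u"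
  by (simp add: wnorm_sq_def)

text \<open>The exact convexity deficit of a quadratic form. It drives the three-point inequality
  and the Cauchy estimate below, and later sorts the quadratic errors of one step of the
  scheme.\<close>

lemma wnorm_sq_convex_comb:
  "wnorm_sq a ((1 - s) *\<^sub>R u + s *\<^sub>R v) =
     (1 - s) * wnorm_sq a u + s * wnorm_sq a v - s * (1 - s) * wnorm_sq a (u - v)"
  unfolding wnorm_sq_add wnorm_sq_diff wnorm_sq_scaleR pair_scale_scaleR inner_scaleR_left
    inner_scaleR_right
  by (simp add: algebra_simps power2_eq_square)

lemma min_norm_le_wnorm_sq: "min (fst a) (snd a) * (norm u)\<^sup>2 \<le> wnorm_sq a u"
proof -
  have "(norm u)\<^sup>2 = (norm (fst u))\<^sup>2 + (norm (snd u))\<^sup>2"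
    by (simp add: norm_prod_def)
  then show ?thesis
    unfolding wnorm_sq_def by (simp add: distrib_left add_mono mult_right_mono)
qed

lemma wnorm_sq_le_max_norm: "wnorm_sq a u \<le> max (fst a) (snd a) * (norm u)\<^sup>2"
proof -
  have "(norm u)\<^sup>2 = (norm (fst u))\<^sup>2 + (norm (snd u))\<^sup>2"
    by (simp add: norm_prod_def)
  then show ?thesis
    unfolding wnorm_sq_def by (simp add: distrib_left add_mono mult_right_mono)
qed

lemma pair_scale_inverse:
  assumes "fst a \<noteq> 0" "snd a \<noteq> 0"
  shows "pair_scale a (pair_scale (pair_inverse a) u) = u"
  using assms by (simp add: pair_scale_def pair_inverse_def)

lemma pair_scale_inverse':
  assumes "fst a \<noteq> 0" "snd a \<noteq> 0"
  shows "pair_scale (pair_inverse a) (pair_scale a u) = u"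
  using assms by (simp add: pair_scale_def pair_inverse_def)

text \<open>Fenchel-Young for half the weighted square: expand the square of
  \<open>pair_scale (pair_inverse a) c - v\<close>.\<close>

lemma wnorm_sq_young:
  assumes "fst a > 0" "snd a > 0"
  shows "c \<bullet> v \<le> 1 / 2 * wnorm_sq (pair_inverse a) c + 1 / 2 * wnorm_sq a v"
proof -
  let ?d = "pair_scale (pair_inverse a) c"
  have c: "pair_scale a ?d = c"
    using assms by (simp add: pair_scale_inverse)
  have "0 \<le> wnorm_sq a (?d - v)"
    using assms by (intro wnorm_sq_nonneg) auto
  also have "\<dots> = wnorm_sq a ?d - 2 * (c \<bullet> v) + wnorm_sq a v"
    by (simp only: wnorm_sq_diff c)
  also have "wnorm_sq a ?d = wnorm_sq (pair_inverse a) c"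
    by (simp add: wnorm_sq_eq c inner_commute)
  finally show ?thesis by simp
qed

subsection \<open>Proximal problems for a convex function with a skew linear minorant\<close>

text \<open>Since \<open>M zs\<close> is orthogonal to \<open>zs\<close>, \<open>minorant\<close>
  says that \<open>M zs\<close> is a subgradient of \<open>F\<close> at \<open>zs\<close>; this is
  all that is kept of the saddle point property. Closedness and convexity are stated for the
  epigraph, whose points carry a real height, so that limits and convex combinations avoid
  \<open>ereal\<close> arithmetic.\<close>

locale skew_gap =
  fixes F :: "'a::euclidean_space \<times> 'b::euclidean_space \<Rightarrow> ereal"
    and M :: "'a \<times> 'b \<Rightarrow> 'a \<times> 'b" and zs :: "'a \<times> 'b"
  assumes lin: "linear M"
    and skew: "M u \<bullet> u = 0"
    and closed_epi: "closed {(u, r::real). F u \<le> ereal r}"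
    and convex_epi: "convex {(u, r::real). F u \<le> ereal r}"
    and finite_zs: "\<bar>F zs\<bar> \<noteq> \<infinity>"
    and minorant: "F zs + ereal (M zs \<bullet> u) \<le> F u"
begin

lemma skew_commute: "M u \<bullet> v = - (u \<bullet> M v)"
proof -
  have "M (u + v) \<bullet> (u + v) = 0" by (rule skew)
  then show ?thesis
    by (simp add: linear_add[OF lin] inner_add_left inner_add_right skew inner_commute[of u])
qed

lemma F_not_MInf: "F u \<noteq> -\<infinity>"
  using minorant[of u] finite_zs by (cases "F zs"; cases "F u") auto

lemma F_real: "F u \<noteq> \<infinity> \<Longrightarrow> F u = ereal (real_of_ereal (F u))"
  using F_not_MInf[of u] by (cases "F u") auto

lemma F_convex_le:
  assumes "F u \<le> ereal a" "F v \<le> ereal b" "0 \<le> s" "s \<le> 1"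
  shows "F ((1 - s) *\<^sub>R u + s *\<^sub>R v) \<le> ereal ((1 - s) * a + s * b)"
  using convexD[OF convex_epi, of "(u, a)" "(v, b)" "1 - s" s] assms by simp

text \<open>Minimality of \<open>p\<close> is tested on the segment towards \<open>u\<close>.
  Dividing by the segment parameter \<open>s\<close> leaves the quadratic gain with the factor
  \<open>1 - s\<close>, which tends to 1 as \<open>s\<close> tends to 0.\<close>

lemma minimiser_three_point:
  fixes l w :: "'a \<times> 'b" and a :: "real \<times> real"
  defines "q \<equiv> \<lambda>u. l \<bullet> u + 1 / 2 * wnorm_sq a (u - w)"
  assumes p: "F p = ereal r" and min: "\<And>u. ereal (r + q p) \<le> F u + ereal (q u)"
    and u: "F u = ereal r'"
  shows "r + q p + 1 / 2 * wnorm_sq a (u - p) \<le> r' + q u"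
proof -
  have "1 / 2 * wnorm_sq a (u - p) \<le> r' + q u - (r + q p)"
  proof (rule field_le_mult_one_interval)
    fix x :: real
    assume x: "0 < x" "x < 1"
    define s where "s = 1 - x"
    have s: "0 < s" "s < 1" and x_eq: "x = 1 - s" using x by (auto simp: s_def)
    let ?v = "(1 - s) *\<^sub>R p + s *\<^sub>R u"
    have "F ?v \<le> ereal ((1 - s) * r + s * r')"
      using F_convex_le[of p r u r' s] p u s by simp
    then have "ereal (r + q p) \<le> ereal ((1 - s) * r + s * r') + ereal (q ?v)"
      using min[of ?v] by (meson add_right_mono order_trans)
    then have 1: "r + q p \<le> (1 - s) * r + s * r' + q ?v" by simp
    have "?v - w = (1 - s) *\<^sub>R (p - w) + s *\<^sub>R (u - w)"
      by (simp add: algebra_simps)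
    then have "q ?v = (1 - s) * q p + s * q u - s * (1 - s) / 2 * wnorm_sq a (u - p)"
      unfolding q_def
      by (simp add: wnorm_sq_convex_comb inner_add_right wnorm_sq_minus_commute[of a p u])
        (simp add: field_simps)
    with 1 have "s * (x * (1 / 2 * wnorm_sq a (u - p))) \<le> s * (r' + q u - (r + q p))"
      by (simp add: x_eq algebra_simps)
    then show "x * (1 / 2 * wnorm_sq a (u - p)) \<le> r' + q u - (r + q p)"
      using s by (simp add: mult_le_cancel_left)
  qed
  then show ?thesis by simp
qed

text \<open>Direct method in which strong convexity stands in for compactness: the objective is
  bounded below by \<open>minorant\<close> and Young's inequality, a minimising sequence is Cauchy
  by a midpoint argument, and the closed epigraph admits the limit.\<close>

lemma minimiser_exists:
  fixes l w :: "'a \<times> 'b" and a :: "real \<times> real"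
  defines "q \<equiv> \<lambda>u. l \<bullet> u + 1 / 2 * wnorm_sq a (u - w)"
  assumes a: "fst a > 0" "snd a > 0"
  obtains p r where "F p = ereal r" "\<And>u. ereal (r + q p) \<le> F u + ereal (q u)"
proof -
  \<comment> \<open>Heights range over the epigraph instead of the values of \<open>F\<close>, so
    that the infimum is taken in the reals.\<close>
  define S where "S = {r + q u | u r. F u \<le> ereal r}"
  obtain fs where fs: "F zs = ereal fs" using finite_zs by (cases "F zs") auto
  define c where "c = M zs + l"
  have low: "fs + c \<bullet> w - 1 / 2 * wnorm_sq (pair_inverse a) (- c) \<le> r + q u"
    if "F u \<le> ereal r" for u r
  proof -
    have "ereal (fs + M zs \<bullet> u) \<le> ereal r"
      using minorant[of u] that fs by (metis order_trans plus_ereal.simps(1))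
    then have "fs + M zs \<bullet> u \<le> r" by simp
    moreover have "(- c) \<bullet> (u - w) \<le>
        1 / 2 * wnorm_sq (pair_inverse a) (- c) + 1 / 2 * wnorm_sq a (u - w)"
      using wnorm_sq_young[OF a] .
    ultimately show ?thesis
      by (simp add: q_def c_def inner_add_left inner_diff_left inner_diff_right)
  qed
  have bdd: "bdd_below S"
    unfolding S_def by (rule bdd_belowI) (use low in blast)
  have "fs + q zs \<in> S" unfolding S_def using eq_refl[OF fs] by blast
  then have ne: "S \<noteq> {}" by auto
  define m where "m = Inf S"
  have m_le: "m \<le> r + q u" if "F u \<le> ereal r" for u r
    unfolding m_def by (rule cInf_lower[OF _ bdd]) (use that in \<open>unfold S_def, blast\<close>)
  have "\<exists>u r. F u \<le> ereal r \<and> r + q u < m + 1 / real (Suc n)" for n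
  proof -
    have "Inf S < m + 1 / real (Suc n)" by (simp add: m_def)
    then obtain x where "x \<in> S" "x < m + 1 / real (Suc n)"
      using cInf_lessD[OF ne] by blast
    then show ?thesis by (auto simp: S_def)
  qed
  then obtain u r where ur: "\<And>n. F (u n) \<le> ereal (r n)"
      "\<And>n. r n + q (u n) < m + 1 / real (Suc n)"
    by metis
  \<comment> \<open>The objective at the midpoint is at least \<open>m\<close>, but at most the mean
    of the two values minus an eighth of the squared distance; hence the factor 8 / 2 = 4.\<close>
  have close: "wnorm_sq a (u i - u j) \<le> 4 * (1 / real (Suc i) + 1 / real (Suc j))" for i j
  proof -
    let ?v = "(1 - 1/2) *\<^sub>R u i + (1/2) *\<^sub>R u j"
    have "F ?v \<le> ereal ((1 - 1/2) * r i + (1/2) * r j)"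
      by (rule F_convex_le) (use ur in auto)
    from m_le[OF this] have 1: "m \<le> (r i + r j) / 2 + q ?v" by (simp add: add_divide_distrib)
    have "?v - w = (1 - 1/2) *\<^sub>R (u i - w) + (1/2) *\<^sub>R (u j - w)"
      by (simp add: algebra_simps flip: scaleR_add_left)
    then have "q ?v = q (u i) / 2 + q (u j) / 2 - 1 / 8 * wnorm_sq a (u i - u j)"
      unfolding q_def by (simp only: wnorm_sq_convex_comb) (simp add: inner_add_right field_simps)
    moreover have "W \<le> 4 * (x + y)"
      if "m \<le> (c + d) / 2 + Q" "Q = c' / 2 + d' / 2 - 1 / 8 * W" "c + c' < m + x" "d + d' < m + y"
      for W x y Q c d c' d' :: real
      using that by (simp add: field_simps)
    ultimately show ?thesis using 1 ur(2) by blast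
  qed
  define \<mu> where "\<mu> = min (fst a) (snd a)"
  have \<mu>: "\<mu> > 0" using a by (simp add: \<mu>_def)
  have "Cauchy u"
  proof (rule metric_CauchyI)
    fix e :: real assume e: "0 < e"
    then have "0 < \<mu> * e\<^sup>2 / 8" using \<mu> by simp
    then obtain N where N: "1 / real (Suc N) < \<mu> * e\<^sup>2 / 8"
      using nat_approx_posE by blast
    have "dist (u i) (u j) < e" if ij: "i \<ge> N" "j \<ge> N" for i j
    proof -
      have small: "1 / real (Suc n) < \<mu> * e\<^sup>2 / 8" if "n \<ge> N" for n
        by (rule le_less_trans[OF _ N]) (use that in \<open>simp add: frac_le\<close>)
      have "1 / real (Suc i) + 1 / real (Suc j) < \<mu> * e\<^sup>2 / 8 + \<mu> * e\<^sup>2 / 8"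
        using ij small by (intro add_strict_mono)
      then have "4 * (1 / real (Suc i) + 1 / real (Suc j)) < 4 * (\<mu> * e\<^sup>2 / 8 + \<mu> * e\<^sup>2 / 8)"
        by (rule mult_strict_left_mono) simp
      then have "wnorm_sq a (u i - u j) < 4 * (\<mu> * e\<^sup>2 / 8 + \<mu> * e\<^sup>2 / 8)"
        by (rule le_less_trans[OF close])
      then have "wnorm_sq a (u i - u j) < \<mu> * e\<^sup>2" by simp
      with min_norm_le_wnorm_sq[of a "u i - u j"] have "\<mu> * (norm (u i - u j))\<^sup>2 < \<mu> * e\<^sup>2"
        by (simp add: \<mu>_def)
      then have "(norm (u i - u j))\<^sup>2 < e\<^sup>2" using \<mu> by simp
      then show ?thesis using e by (simp add: dist_norm power_less_imp_less_base)
    qed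
    then show "\<exists>N. \<forall>i\<ge>N. \<forall>j\<ge>N. dist (u i) (u j) < e" by blast
  qed
  then obtain p where p: "u \<longlonglongrightarrow> p" using convergent_eq_Cauchy by blast
  have qlim: "(\<lambda>n. q (u n)) \<longlonglongrightarrow> q p"
    unfolding q_def wnorm_sq_def by (intro tendsto_intros p)
  have lim: "(\<lambda>n. r n + q (u n)) \<longlonglongrightarrow> m"
  proof (rule tendsto_sandwich)
    show "\<forall>\<^sub>F n in sequentially. m \<le> r n + q (u n)"
      using m_le ur(1) by simp
    show "\<forall>\<^sub>F n in sequentially. r n + q (u n) \<le> m + 1 / real (Suc n)"
      using ur(2) by (simp add: less_imp_le)
    show "(\<lambda>n. m + 1 / real (Suc n)) \<longlonglongrightarrow> m"
      using tendsto_add[OF tendsto_const LIMSEQ_Suc[OF lim_1_over_n], of m] by simp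
  qed simp
  have rlim: "r \<longlonglongrightarrow> m - q p"
    using tendsto_diff[OF lim qlim] by simp
  \<comment> \<open>The heights \<open>r n\<close> converge because \<open>r n + q (u n)\<close>
    tends to \<open>m\<close> and \<open>q\<close> is continuous; closedness then bounds
    \<open>F\<close> at the limit.\<close>
  have "(p, m - q p) \<in> {(u, r::real). F u \<le> ereal r}"
    by (rule closed_sequentially[OF closed_epi _ tendsto_Pair[OF p rlim]]) (use ur(1) in auto)
  then have Fp: "F p \<le> ereal (m - q p)" by simp
  then obtain r0 where r0: "F p = ereal r0" using F_not_MInf[of p] by (cases "F p") auto
  have "r0 + q p = m" using Fp m_le[of p r0] r0 by simp
  moreover have "ereal m \<le> F v + ereal (q v)" for v
    using m_le[of v "real_of_ereal (F v)"] F_not_MInf[of v] by (cases "F v") auto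
  ultimately show thesis using that r0 by blast
qed

subsection \<open>The smoothed conjugate and the smoothed gap\<close>

definition conj_real :: "real \<times> real \<Rightarrow> 'a \<times> 'b \<Rightarrow> real" where
  "conj_real \<beta> z = real_of_ereal (smoothed_conj \<beta> M F z)"

text \<open>\<open>real_of_ereal\<close> sends infinity to 0, so this is the smoothed gap only where
  \<open>F z\<close> is finite. The starting point may violate that, but its value will be
  multiplied by \<open>1 - \<theta> 0 = 0\<close>.\<close>

definition gap_real :: "real \<times> real \<Rightarrow> 'a \<times> 'b \<Rightarrow> real" where
  "gap_real \<beta> z = real_of_ereal (F z) + conj_real \<beta> z"

text \<open>Up to sign this is \<open>minimiser_exists\<close> with linear part \<open>- M z\<close>
  and centre \<open>z\<close>; the last clause is the three-point inequality.\<close>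

lemma smoothed_conj_attained:
  assumes \<beta>: "fst \<beta> > 0" "snd \<beta> > 0"
  obtains p r where "F p = ereal r"
    "smoothed_conj \<beta> M F z = ereal (M z \<bullet> p - r - 1 / 2 * wnorm_sq \<beta> (z - p))"
    "\<And>u r'. F u = ereal r' \<Longrightarrow> M z \<bullet> u - r' - 1 / 2 * wnorm_sq \<beta> (z - u) + 1 / 2 * wnorm_sq \<beta> (u - p)
        \<le> M z \<bullet> p - r - 1 / 2 * wnorm_sq \<beta> (z - p)"
proof -
  obtain p r where p: "F p = ereal r" and
    min: "\<And>u. ereal (r + (- M z \<bullet> p + 1 / 2 * wnorm_sq \<beta> (p - z)))
           \<le> F u + ereal (- M z \<bullet> u + 1 / 2 * wnorm_sq \<beta> (u - z))"
    using minimiser_exists[OF \<beta>, of "- M z" z] by blast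
  have three: "M z \<bullet> u - r' - 1 / 2 * wnorm_sq \<beta> (z - u) + 1 / 2 * wnorm_sq \<beta> (u - p)
        \<le> M z \<bullet> p - r - 1 / 2 * wnorm_sq \<beta> (z - p)" if "F u = ereal r'" for u r'
    using minimiser_three_point[OF p min that] wnorm_sq_minus_commute[of \<beta> z]
    by (simp add: wnorm_sq_minus_commute[of \<beta> z])
  have "smoothed_conj \<beta> M F z = ereal (M z \<bullet> p - r - 1 / 2 * wnorm_sq \<beta> (z - p))"
    unfolding smoothed_conj_def
  proof (rule SUP_eqI)
    fix u
    show "ereal (M z \<bullet> u) - F u - ereal (1 / 2 * wnorm_sq \<beta> (z - u))
        \<le> ereal (M z \<bullet> p - r - 1 / 2 * wnorm_sq \<beta> (z - p))"
    proof (cases "F u")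
      case (real r')
      have "0 \<le> wnorm_sq \<beta> (u - p)" using \<beta> by (simp add: wnorm_sq_nonneg)
      with three[OF real] real show ?thesis by simp
    qed (use F_not_MInf[of u] in auto)
  next
    fix y
    assume "\<And>i. i \<in> UNIV \<Longrightarrow> ereal (M z \<bullet> i) - F i - ereal (1 / 2 * wnorm_sq \<beta> (z - i)) \<le> y"
    from this[of p] p show "ereal (M z \<bullet> p - r - 1 / 2 * wnorm_sq \<beta> (z - p)) \<le> y" by simp
  qed
  with p three that show thesis by blast
qed

lemma smoothed_conj_eq_conj_real:
  assumes "fst \<beta> > 0" "snd \<beta> > 0"
  shows "smoothed_conj \<beta> M F z = ereal (conj_real \<beta> z)"
  using smoothed_conj_attained[OF assms, of z] by (metis conj_real_def real_of_ereal.simps(1))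

lemma smoothed_gap_eq_gap_real:
  assumes "fst \<beta> > 0" "snd \<beta> > 0" "F z \<noteq> \<infinity>"
  shows "smoothed_gap \<beta> M F z = ereal (gap_real \<beta> z)"
  unfolding smoothed_gap_def gap_real_def
  by (subst F_real) (simp_all add: assms smoothed_conj_eq_conj_real)

lemma conj_real_upper:
  assumes "fst \<beta> > 0" "snd \<beta> > 0" "F u = ereal r"
  shows "M z \<bullet> u - r - 1 / 2 * wnorm_sq \<beta> (z - u) \<le> conj_real \<beta> z"
proof -
  have "ereal (M z \<bullet> u) - F u - ereal (1 / 2 * wnorm_sq \<beta> (z - u)) \<le> smoothed_conj \<beta> M F z"
    unfolding smoothed_conj_def by (rule SUP_upper) simp
  then show ?thesis using assms by (simp add: smoothed_conj_eq_conj_real)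
qed

text \<open>Lower bound: the maximiser \<open>p\<close> at \<open>z\<close> is a competitor at
  \<open>z + d\<close>. Upper bound: the maximiser \<open>u\<close> at \<open>z + d\<close> is
  inserted into the three-point inequality at \<open>z\<close>, whose gain pays for the distance
  from \<open>u\<close> to \<open>p\<close> in Young's inequality for
  \<open>M d + pair_scale \<beta> d\<close>. Skewness makes these two summands orthogonal in the
  inverse weight, and the square of \<open>d\<close> that appears cancels against the one in
  \<open>shift\<close>.\<close>

lemma conj_real_expansion:
  assumes \<beta>: "fst \<beta> > 0" "snd \<beta> > 0"
  obtains D where
    "\<And>d. conj_real \<beta> z + D \<bullet> d - 1 / 2 * wnorm_sq \<beta> d \<le> conj_real \<beta> (z + d)"
    "\<And>d. conj_real \<beta> (z + d) \<le> conj_real \<beta> z + D \<bullet> d + 1 / 2 * wnorm_sq (pair_inverse \<beta>) (M d)"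
proof -
  obtain p r where p: "F p = ereal r"
    and val: "smoothed_conj \<beta> M F z = ereal (M z \<bullet> p - r - 1 / 2 * wnorm_sq \<beta> (z - p))"
    and three: "\<And>u r'. F u = ereal r' \<Longrightarrow>
        M z \<bullet> u - r' - 1 / 2 * wnorm_sq \<beta> (z - u) + 1 / 2 * wnorm_sq \<beta> (u - p)
        \<le> M z \<bullet> p - r - 1 / 2 * wnorm_sq \<beta> (z - p)"
    by (rule smoothed_conj_attained[OF \<beta>, of z]) (rule that)
  have h: "conj_real \<beta> z = M z \<bullet> p - r - 1 / 2 * wnorm_sq \<beta> (z - p)"
    by (simp add: conj_real_def val)
  \<comment> \<open>The gradient formula \<open>- M zbar + \<beta>.(zbar - z)\<close>, with
    \<open>p\<close> as the point \<open>zbar\<close> attached to \<open>z\<close>.\<close>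
  define D where "D = pair_scale \<beta> (p - z) - M p"
  have shift: "wnorm_sq \<beta> (z + d - u)
      = wnorm_sq \<beta> (z - u) + 2 * (pair_scale \<beta> (z - u) \<bullet> d) + wnorm_sq \<beta> d" for d u
    using wnorm_sq_add[of \<beta> "z - u" d] by (simp add: algebra_simps)
  have Md: "M d \<bullet> p = - (M p \<bullet> d)" for d
    using skew_commute[of d p] by (simp add: inner_commute)
  show thesis
  proof (rule that[of D])
    fix d
    have "M (z + d) \<bullet> p - r - 1 / 2 * wnorm_sq \<beta> (z + d - p) \<le> conj_real \<beta> (z + d)"
      by (rule conj_real_upper[OF \<beta> p])
    then show "conj_real \<beta> z + D \<bullet> d - 1 / 2 * wnorm_sq \<beta> d \<le> conj_real \<beta> (z + d)"
      unfolding shift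
      by (simp add: h linear_add[OF lin] inner_add_left Md D_def inner_diff_left
          pair_scale_diff algebra_simps)
  next
    fix d
    obtain u r' where u: "F u = ereal r'"
      and val': "smoothed_conj \<beta> M F (z + d)
          = ereal (M (z + d) \<bullet> u - r' - 1 / 2 * wnorm_sq \<beta> (z + d - u))"
      by (rule smoothed_conj_attained[OF \<beta>, of "z + d"]) (rule that)
    have h': "conj_real \<beta> (z + d) = M (z + d) \<bullet> u - r' - 1 / 2 * wnorm_sq \<beta> (z + d - u)"
      by (simp add: conj_real_def val')
    let ?c = "M d + pair_scale \<beta> d"
    have "?c \<bullet> (u - p) \<le> 1 / 2 * wnorm_sq (pair_inverse \<beta>) ?c + 1 / 2 * wnorm_sq \<beta> (u - p)"
      by (rule wnorm_sq_young[OF \<beta>])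
    also have "wnorm_sq (pair_inverse \<beta>) ?c = wnorm_sq (pair_inverse \<beta>) (M d) + wnorm_sq \<beta> d"
    proof -
      have "pair_scale (pair_inverse \<beta>) (M d) \<bullet> pair_scale \<beta> d = 0"
        using pair_scale_commute[of "pair_inverse \<beta>" "M d" "pair_scale \<beta> d"] \<beta>
        by (simp add: pair_scale_inverse' inner_commute[of d] skew)
      moreover have "wnorm_sq (pair_inverse \<beta>) (pair_scale \<beta> d) = wnorm_sq \<beta> d"
        using \<beta> by (simp add: wnorm_sq_eq pair_scale_inverse' inner_commute)
      ultimately show ?thesis by (simp add: wnorm_sq_add)
    qed
    finally have young: "M d \<bullet> (u - p) + pair_scale \<beta> (u - p) \<bullet> d
      \<le> 1 / 2 * (wnorm_sq (pair_inverse \<beta>) (M d) + wnorm_sq \<beta> d) + 1 / 2 * wnorm_sq \<beta> (u - p)"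
      using pair_scale_commute[of \<beta> d "u - p"] by (simp add: inner_add_left)
    show "conj_real \<beta> (z + d)
        \<le> conj_real \<beta> z + D \<bullet> d + 1 / 2 * wnorm_sq (pair_inverse \<beta>) (M d)"
      using three[OF u] young unfolding h' shift
      by (simp add: h linear_add[OF lin] inner_add_left Md D_def inner_diff_left
          inner_diff_right pair_scale_diff algebra_simps)
  qed
qed

text \<open>Both remainders in \<open>conj_real_expansion\<close> are quadratic in \<open>d\<close>,
  so its vector is the Frechet gradient; by uniqueness the description operator in
  \<open>gradient\<close> returns that vector.\<close>

lemma grad_smoothed_conj_expansion:
  assumes \<beta>: "fst \<beta> > 0" "snd \<beta> > 0"
  defines "D \<equiv> \<lambda>z. grad_smoothed_conj \<beta> M F z"
  shows "conj_real \<beta> z + D z \<bullet> d - 1 / 2 * wnorm_sq \<beta> d \<le> conj_real \<beta> (z + d)"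
    and "conj_real \<beta> (z + d) \<le> conj_real \<beta> z + D z \<bullet> d + 1 / 2 * wnorm_sq (pair_inverse \<beta>) (M d)"
proof -
  obtain E where low: "\<And>d. conj_real \<beta> z + E \<bullet> d - 1 / 2 * wnorm_sq \<beta> d \<le> conj_real \<beta> (z + d)"
    and up: "\<And>d. conj_real \<beta> (z + d)
          \<le> conj_real \<beta> z + E \<bullet> d + 1 / 2 * wnorm_sq (pair_inverse \<beta>) (M d)"
    using conj_real_expansion[OF \<beta>, of z] by blast
  obtain L where L: "\<And>d. norm (M d) \<le> L * norm d"
    using linear_bounded[OF lin] by blast
  define a where "a = max (fst \<beta>) (snd \<beta>)"
  define c where "c = max (fst (pair_inverse \<beta>)) (snd (pair_inverse \<beta>))"
  have a: "a > 0" and c: "c > 0" using \<beta> by (auto simp: a_def c_def pair_inverse_def less_max_iff_disj)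
  define C where "C = 1 / 2 * a + 1 / 2 * (c * L\<^sup>2)"
  have rem: "\<bar>conj_real \<beta> (z + d) - conj_real \<beta> z - E \<bullet> d\<bar> \<le> C * (norm d)\<^sup>2" for d
  proof -
    have 1: "wnorm_sq \<beta> d \<le> a * (norm d)\<^sup>2"
      using wnorm_sq_le_max_norm[of \<beta> d] by (simp add: a_def)
    have "(norm (M d))\<^sup>2 \<le> L\<^sup>2 * (norm d)\<^sup>2"
      using power_mono[OF L, of d 2] by (simp add: power_mult_distrib)
    then have "c * (norm (M d))\<^sup>2 \<le> c * (L\<^sup>2 * (norm d)\<^sup>2)"
      using c by simp
    then have 2: "wnorm_sq (pair_inverse \<beta>) (M d) \<le> c * (L\<^sup>2 * (norm d)\<^sup>2)"
      using wnorm_sq_le_max_norm[of "pair_inverse \<beta>" "M d"] by (simp add: c_def)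
    have C: "C * (norm d)\<^sup>2 = 1 / 2 * (a * (norm d)\<^sup>2) + 1 / 2 * (c * (L\<^sup>2 * (norm d)\<^sup>2))"
      by (simp add: C_def algebra_simps)
    have "0 \<le> a * (norm d)\<^sup>2" "0 \<le> c * (L\<^sup>2 * (norm d)\<^sup>2)" using a c by simp_all
    then show ?thesis
      using low[of d] up[of d] 1 2 C by linarith
  qed
  have "((\<lambda>y. conj_real \<beta> y) has_derivative (\<lambda>h. h \<bullet> E)) (at z)"
    unfolding has_derivative_at_alt
  proof (intro conjI allI impI)
    show "bounded_linear (\<lambda>h. h \<bullet> E)" by (rule bounded_linear_inner_left)
    fix e :: real assume e: "0 < e"
    define \<delta> where "\<delta> = e / (\<bar>C\<bar> + 1)"
    have "norm (conj_real \<beta> y - conj_real \<beta> z - (y - z) \<bullet> E) \<le> e * norm (y - z)"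
      if y: "norm (y - z) < \<delta>" for y
    proof -
      have "norm (conj_real \<beta> y - conj_real \<beta> z - (y - z) \<bullet> E) \<le> C * (norm (y - z))\<^sup>2"
        using rem[of "y - z"] by (simp add: inner_commute)
      also have "\<dots> = (C * norm (y - z)) * norm (y - z)" by (simp add: power2_eq_square)
      also have "\<dots> \<le> e * norm (y - z)"
      proof (rule mult_right_mono)
        have "C * norm (y - z) \<le> (\<bar>C\<bar> + 1) * norm (y - z)"
          by (rule mult_right_mono) auto
        also have "\<dots> \<le> (\<bar>C\<bar> + 1) * \<delta>" using y by (intro mult_left_mono) auto
        also have "\<dots> = e" by (simp add: \<delta>_def)
        finally show "C * norm (y - z) \<le> e" .
      qed simp
      finally show ?thesis .
    qed
    moreover have "\<delta> > 0" using e by (simp add: \<delta>_def add_nonneg_pos)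
    ultimately show "\<exists>d>0. \<forall>y. norm (y - z) < d \<longrightarrow>
        norm (conj_real \<beta> y - conj_real \<beta> z - (y - z) \<bullet> E) \<le> e * norm (y - z)" by blast
  qed
  then have E: "GDERIV (\<lambda>y. conj_real \<beta> y) z :> E"
    unfolding gderiv_def by simp
  have "D z = E"
    unfolding D_def grad_smoothed_conj_def gradient_def conj_real_def[symmetric]
  proof (rule the_equality)
    show "GDERIV (\<lambda>y. conj_real \<beta> y) z :> E" by (rule E)
  next
    fix E' assume "GDERIV (\<lambda>y. conj_real \<beta> y) z :> E'"
    then have "(\<lambda>h. h \<bullet> E') = (\<lambda>h. h \<bullet> E)"
      using E unfolding gderiv_def by (rule has_derivative_unique)
    then have "(E' - E) \<bullet> E' = (E' - E) \<bullet> E" by meson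
    then have "(E' - E) \<bullet> (E' - E) = 0" by (simp add: inner_diff_right)
    then show "E' = E" by simp
  qed
  then show "conj_real \<beta> z + D z \<bullet> d - 1 / 2 * wnorm_sq \<beta> d \<le> conj_real \<beta> (z + d)"
    and "conj_real \<beta> (z + d) \<le> conj_real \<beta> z + D z \<bullet> d + 1 / 2 * wnorm_sq (pair_inverse \<beta>) (M d)"
    using low up by auto
qed

text \<open>By \<open>minorant\<close>, \<open>M zs \<bullet> u - F u\<close> never exceeds
  \<open>- F zs\<close>, and the smoothing term only lowers it. The comparison point thus
  contributes no gap to \<open>accelerated_step\<close>.\<close>

lemma conj_real_zs:
  assumes \<beta>: "fst \<beta> > 0" "snd \<beta> > 0"
  shows "conj_real \<beta> zs \<le> - real_of_ereal (F zs)"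
proof -
  obtain p r where p: "F p = ereal r"
    and val: "smoothed_conj \<beta> M F zs = ereal (M zs \<bullet> p - r - 1 / 2 * wnorm_sq \<beta> (zs - p))"
    by (rule smoothed_conj_attained[OF \<beta>, of zs]) (rule that)
  have "real_of_ereal (F zs) + M zs \<bullet> p \<le> r"
    using minorant[of p] p finite_zs by (cases "F zs") auto
  moreover have "0 \<le> wnorm_sq \<beta> (zs - p)" using \<beta> by (simp add: wnorm_sq_nonneg)
  ultimately show ?thesis by (simp add: conj_real_def val)
qed

text \<open>The competitor \<open>z' = z\<close> in the supremum: its linear term vanishes by
  skewness.\<close>

lemma gap_real_nonneg:
  assumes "fst \<beta> > 0" "snd \<beta> > 0" "F z \<noteq> \<infinity>"
  shows "0 \<le> gap_real \<beta> z"
  using conj_real_upper[OF assms(1,2) F_real[OF assms(3)], of z]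
  by (simp add: gap_real_def skew wnorm_sq_def)

text \<open>With \<open>p\<close> the maximiser for the smaller weight, the competitor for
  \<open>\<beta>\<close> is \<open>?w\<close>. Its displacement from \<open>z\<close> is
  \<open>\<rho>\<close> times that of \<open>p\<close>, so the quadratic term carries \<rho> twice,
  once for the weight and once for the prefactor. Convexity bounds \<open>F\<close> at
  \<open>?w\<close>, and skewness scales the linear term.\<close>

lemma gap_real_scaleR_le:
  assumes \<beta>: "fst \<beta> > 0" "snd \<beta> > 0" and z: "F z \<noteq> \<infinity>" and \<rho>: "0 < \<rho>" "\<rho> \<le> 1"
  shows "\<rho> * gap_real (\<rho> *\<^sub>R \<beta>) z \<le> gap_real \<beta> z"
proof -
  have \<rho>\<beta>: "fst (\<rho> *\<^sub>R \<beta>) > 0" "snd (\<rho> *\<^sub>R \<beta>) > 0" using \<beta> \<rho> by simp_all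
  obtain p r where p: "F p = ereal r" and
    val: "smoothed_conj (\<rho> *\<^sub>R \<beta>) M F z = ereal (M z \<bullet> p - r - 1 / 2 * wnorm_sq (\<rho> *\<^sub>R \<beta>) (z - p))"
    by (rule smoothed_conj_attained[OF \<rho>\<beta>, of z]) (rule that)
  define \<phi> where "\<phi> = real_of_ereal (F z)"
  have \<phi>: "F z = ereal \<phi>" using F_real[OF z] by (simp add: \<phi>_def)
  let ?w = "(1 - \<rho>) *\<^sub>R z + \<rho> *\<^sub>R p"
  have le: "F ?w \<le> ereal ((1 - \<rho>) * \<phi> + \<rho> * r)"
    using F_convex_le[of z \<phi> p r \<rho>] \<phi> p \<rho> by simp
  then obtain \<omega> where \<omega>: "F ?w = ereal \<omega>" using F_not_MInf[of ?w] by (cases "F ?w") auto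
  have "z - ?w = \<rho> *\<^sub>R (z - p)" by (simp add: algebra_simps)
  with conj_real_upper[OF \<beta> \<omega>, of z]
  have "\<rho> * (M z \<bullet> p) - \<omega> - 1 / 2 * (\<rho>\<^sup>2 * wnorm_sq \<beta> (z - p)) \<le> conj_real \<beta> z"
    by (simp add: wnorm_sq_scaleR inner_add_right skew)
  with le \<omega> show ?thesis
    unfolding gap_real_def conj_real_def[of "\<rho> *\<^sub>R \<beta>"] val \<phi>
    by (simp add: wnorm_sq_weight_scaleR algebra_simps power2_eq_square)
qed

section \<open>One step of the accelerated proximal gradient scheme\<close>

lemma prox_three_point:
  assumes \<tau>: "fst \<tau> > 0" "snd \<tau> > 0" and p: "p = prox \<tau> F (y - pair_scale \<tau> D)"
  shows "F p \<noteq> \<infinity>"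
    and "F u \<noteq> \<infinity> \<Longrightarrow> real_of_ereal (F p) + D \<bullet> p + 1 / 2 * wnorm_sq (pair_inverse \<tau>) (p - y)
        + 1 / 2 * wnorm_sq (pair_inverse \<tau>) (u - p)
      \<le> real_of_ereal (F u) + D \<bullet> u + 1 / 2 * wnorm_sq (pair_inverse \<tau>) (u - y)"
proof -
  let ?a = "pair_inverse \<tau>"
  have a: "fst ?a > 0" "snd ?a > 0" using \<tau> by (simp_all add: pair_inverse_def)
  define w where "w = y - pair_scale \<tau> D"
  define obj where "obj = (\<lambda>u. F u + ereal (1 / 2 * wnorm_sq ?a (u - w)))"
  obtain p0 r0 where p0: "F p0 = ereal r0"
    and min0: "\<And>u. ereal (r0 + (0 \<bullet> p0 + 1 / 2 * wnorm_sq ?a (p0 - w)))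
        \<le> F u + ereal (0 \<bullet> u + 1 / 2 * wnorm_sq ?a (u - w))"
    using minimiser_exists[OF a, of 0 w] by blast
  \<comment> \<open>\<open>ARG_MIN\<close> is a choice operator: it is the existence of the
    minimiser \<open>p0\<close> that makes \<open>p\<close> a minimiser.\<close>
  have "is_arg_min obj (\<lambda>_. True) p0"
    using min0 p0 by (auto simp: is_arg_min_def obj_def not_less)
  then have "is_arg_min obj (\<lambda>_. True) p"
    unfolding p prox_def arg_min_def w_def[symmetric] obj_def[symmetric] by (rule someI)
  then have min: "obj p \<le> obj u" for u unfolding is_arg_min_def by (meson not_less)
  have "obj p0 \<noteq> \<infinity>" by (simp add: obj_def p0)
  with min[of p0] show fin: "F p \<noteq> \<infinity>" by (auto simp: obj_def)
  define r where "r = real_of_ereal (F p)"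
  have r: "F p = ereal r" using F_real[OF fin] by (simp add: r_def)
  have min': "ereal (r + (0 \<bullet> p + 1 / 2 * wnorm_sq ?a (p - w)))
      \<le> F u + ereal (0 \<bullet> u + 1 / 2 * wnorm_sq ?a (u - w))" for u
    using min[of u] r by (simp add: obj_def)
  \<comment> \<open>Completing the square: the cross term with the shift
    \<open>pair_scale \<tau> D\<close> is the linearisation \<open>D \<bullet> (u - y)\<close>, and
    the last term does not depend on \<open>u\<close>.\<close>
  have sq: "wnorm_sq ?a (u - w) = wnorm_sq ?a (u - y) + 2 * (D \<bullet> (u - y)) + wnorm_sq ?a (pair_scale \<tau> D)"
    for u
  proof -
    have "u - w = (u - y) + pair_scale \<tau> D" by (simp add: w_def)
    moreover have "pair_scale ?a (u - y) \<bullet> pair_scale \<tau> D = D \<bullet> (u - y)"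
      using pair_scale_commute[of ?a "u - y" "pair_scale \<tau> D"] \<tau> by (simp add: pair_scale_inverse')
    ultimately show ?thesis by (simp only: wnorm_sq_add)
  qed
  show "real_of_ereal (F p) + D \<bullet> p + 1 / 2 * wnorm_sq ?a (p - y) + 1 / 2 * wnorm_sq ?a (u - p)
      \<le> real_of_ereal (F u) + D \<bullet> u + 1 / 2 * wnorm_sq ?a (u - y)" if "F u \<noteq> \<infinity>"
    using minimiser_three_point[OF r min' F_real[OF that]] unfolding sq r_def
    by (simp add: inner_diff_right field_simps)
qed

text \<open>The upper expansion bounds the conjugate at \<open>z'\<close>, the lower one is used at
  \<open>z\<close> and \<open>zs\<close> with weights \<open>1 - \<theta>\<close> and
  \<open>\<theta>\<close>, and the prox inequality is compared with \<open>zs\<close>. The lower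
  expansion falls short of convexity by half a square in the norm of \<open>\<beta>\<close>, the
  source of the \<open>\<beta>\<close> terms. The alternative \<open>\<theta> = 1\<close> admits a
  starting point outside the domain of \<open>F\<close>.\<close>

lemma accelerated_step:
  assumes \<beta>: "fst \<beta> > 0" "snd \<beta> > 0" and \<gamma>: "fst \<gamma> > 0" "snd \<gamma> > 0"
    and smooth: "\<And>d. wnorm_sq (pair_inverse \<beta>) (M d) \<le> wnorm_sq (pair_inverse \<gamma>) d"
    and \<theta>: "0 < \<theta>" "\<theta> \<le> 1" and z: "\<theta> = 1 \<or> F z \<noteq> \<infinity>"
    and zh: "zh = (1 - \<theta>) *\<^sub>R z + \<theta> *\<^sub>R y"
    and y': "y' = prox ((1 / \<theta>) *\<^sub>R \<gamma>) F
          (y - pair_scale ((1 / \<theta>) *\<^sub>R \<gamma>) (grad_smoothed_conj \<beta> M F zh))"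
    and z': "z' = (1 - \<theta>) *\<^sub>R z + \<theta> *\<^sub>R y'"
  shows "F z' \<noteq> \<infinity>"
    and "gap_real \<beta> z' \<le> (1 - \<theta>) * gap_real \<beta> z
      + \<theta>\<^sup>2 / 2 * (wnorm_sq (pair_inverse \<gamma> + \<beta>) (y - zs) - wnorm_sq (pair_inverse \<gamma>) (y' - zs))
      + \<theta> * (1 - \<theta>) / 2 * wnorm_sq \<beta> (z - zs)"
proof -
  define D where "D = grad_smoothed_conj \<beta> M F zh"
  define G where "G = pair_inverse \<gamma>"
  define \<phi> where "\<phi> = (\<lambda>u. real_of_ereal (F u))"
  define h where "h = conj_real \<beta>"
  have \<tau>: "fst ((1 / \<theta>) *\<^sub>R \<gamma>) > 0" "snd ((1 / \<theta>) *\<^sub>R \<gamma>) > 0" using \<gamma> \<theta> by simp_all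
  have inv: "pair_inverse ((1 / \<theta>) *\<^sub>R \<gamma>) = \<theta> *\<^sub>R G"
    by (simp add: pair_inverse_def G_def)
  note prox3 = prox_three_point[OF \<tau> y'[folded D_def], unfolded inv wnorm_sq_weight_scaleR]
  have Fy': "F y' = ereal (\<phi> y')" using F_real[OF prox3(1)] by (simp add: \<phi>_def)
  have "F zs \<noteq> \<infinity>" using finite_zs by auto
  from prox3(2)[OF this] have
    three: "\<phi> y' + D \<bullet> y' + 1 / 2 * (\<theta> * wnorm_sq G (y' - y)) + 1 / 2 * (\<theta> * wnorm_sq G (zs - y'))
      \<le> \<phi> zs + D \<bullet> zs + 1 / 2 * (\<theta> * wnorm_sq G (zs - y))"
    by (simp add: \<phi>_def)
  have Fz': "F z' \<le> ereal ((1 - \<theta>) * \<phi> z + \<theta> * \<phi> y')"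
    using z
  proof
    assume "\<theta> = 1" then show ?thesis using Fy' z' by simp
  next
    assume "F z \<noteq> \<infinity>"
    then have "F z = ereal (\<phi> z)" using F_real by (simp add: \<phi>_def)
    then show ?thesis unfolding z' using Fy' \<theta> by (intro F_convex_le) auto
  qed
  then show "F z' \<noteq> \<infinity>" by auto
  then have convex: "\<phi> z' \<le> (1 - \<theta>) * \<phi> z + \<theta> * \<phi> y'"
    using Fz' F_real[of z'] by (metis \<phi>_def ereal_less_eq(3))
  \<comment> \<open>The resulting square of \<open>\<theta>\<close> makes the quadratic term of
    \<open>descent\<close> cancel exactly against that of \<open>three\<close> multiplied by
    \<open>\<theta>\<close>.\<close>
  have diff: "z' - zh = \<theta> *\<^sub>R (y' - y)" by (simp add: z' zh algebra_simps)
  have "h z' \<le> h zh + D \<bullet> (z' - zh) + 1 / 2 * wnorm_sq (pair_inverse \<beta>) (M (z' - zh))"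
    using grad_smoothed_conj_expansion(2)[OF \<beta>, of zh "z' - zh"] by (simp add: D_def h_def)
  with smooth[of "z' - zh"]
  have descent: "h z' \<le> h zh + D \<bullet> (z' - zh) + 1 / 2 * (\<theta>\<^sup>2 * wnorm_sq G (y' - y))"
    by (simp add: G_def diff wnorm_sq_scaleR)
  have low: "h zh + D \<bullet> (u - zh) - 1 / 2 * wnorm_sq \<beta> (u - zh) \<le> h u" for u
    using grad_smoothed_conj_expansion(1)[OF \<beta>, of zh "u - zh"] by (simp add: D_def h_def)
  have "\<theta> * (h zh + D \<bullet> (zs - zh) - 1 / 2 * wnorm_sq \<beta> (zs - zh)) \<le> \<theta> * - \<phi> zs"
    using low[of zs] conj_real_zs[OF \<beta>] \<theta> by (intro mult_left_mono) (auto simp: h_def \<phi>_def)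
  moreover have "(1 - \<theta>) * (h zh + D \<bullet> (z - zh) - 1 / 2 * wnorm_sq \<beta> (z - zh)) \<le> (1 - \<theta>) * h z"
    using low[of z] \<theta> by (intro mult_left_mono) auto
  moreover have "\<theta> * (\<phi> y' + D \<bullet> y' + 1 / 2 * (\<theta> * wnorm_sq G (y' - y)) + 1 / 2 * (\<theta> * wnorm_sq G (zs - y')))
      \<le> \<theta> * (\<phi> zs + D \<bullet> zs + 1 / 2 * (\<theta> * wnorm_sq G (zs - y)))"
    using three \<theta> by (intro mult_left_mono) auto
  \<comment> \<open>The two deficits of the lower expansion are squares of distances to
    \<open>zh\<close>. Since \<open>\<theta> *\<^sub>R (zs - y)\<close> is the convex combination of
    the two displacements, the deficit identity turns them into distances to
    \<open>zs\<close>.\<close>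
  moreover have "\<theta>\<^sup>2 * wnorm_sq \<beta> (zs - y) =
      (1 - \<theta>) * wnorm_sq \<beta> (z - zh) + \<theta> * wnorm_sq \<beta> (zs - zh) - \<theta> * (1 - \<theta>) * wnorm_sq \<beta> (z - zs)"
  proof -
    have "\<theta> *\<^sub>R (zs - y) = (1 - \<theta>) *\<^sub>R (z - zh) + \<theta> *\<^sub>R (zs - zh)"
      by (simp add: zh algebra_simps)
    then have "\<theta>\<^sup>2 * wnorm_sq \<beta> (zs - y) = wnorm_sq \<beta> ((1 - \<theta>) *\<^sub>R (z - zh) + \<theta> *\<^sub>R (zs - zh))"
      by (metis wnorm_sq_scaleR)
    then show ?thesis by (simp add: wnorm_sq_convex_comb)
  qed
  moreover have "D \<bullet> zh = (1 - \<theta>) * (D \<bullet> z) + \<theta> * (D \<bullet> y)"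
    by (simp add: zh inner_add_right)
  moreover have "D \<bullet> (z' - zh) = \<theta> * (D \<bullet> y') - \<theta> * (D \<bullet> y)"
    by (simp add: diff inner_diff_right algebra_simps)
  ultimately have "\<phi> z' + h z' \<le> (1 - \<theta>) * (\<phi> z + h z)
      + \<theta>\<^sup>2 / 2 * (wnorm_sq G (zs - y) + wnorm_sq \<beta> (zs - y) - wnorm_sq G (zs - y'))
      + \<theta> * (1 - \<theta>) / 2 * wnorm_sq \<beta> (z - zs)"
    using descent convex
    by (simp add: inner_diff_right algebra_simps power2_eq_square add_divide_distrib
        diff_divide_distrib)
  then show "gap_real \<beta> z' \<le> (1 - \<theta>) * gap_real \<beta> z
      + \<theta>\<^sup>2 / 2 * (wnorm_sq (pair_inverse \<gamma> + \<beta>) (y - zs) - wnorm_sq (pair_inverse \<gamma>) (y' - zs))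
      + \<theta> * (1 - \<theta>) / 2 * wnorm_sq \<beta> (z - zs)"
    by (simp add: gap_real_def \<phi>_def h_def G_def wnorm_sq_weight_add
        wnorm_sq_minus_commute[of _ zs])
qed

end

subsection \<open>Saddle functions\<close>

text \<open>\<open>Liminf (at x)\<close> looks at punctured neighbourhoods; at \<open>x\<close>
  itself the condition is the premise \<open>C < f x\<close>.\<close>

lemma lsc_fun_iff:
  "lsc_fun f \<longleftrightarrow> (\<forall>x C. C < f x \<longrightarrow> (\<forall>\<^sub>F y in nhds x. C < f y))"
  unfolding lsc_fun_def le_Liminf_iff eventually_nhds_conv_at by blast

lemma closed_epigraph:
  assumes "lsc_fun f"
  shows "closed {(u, r::real). f u \<le> ereal r}"
proof -
  have "open {(u, r::real). ereal r < f u}"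
  proof (subst open_subopen, clarify)
    fix u and r :: real assume "ereal r < f u"
    then obtain q where q: "ereal r < q" "q < f u" using dense by blast
    obtain s where s: "ereal r < ereal s" "ereal s < f u"
      using q by (cases q) auto
    from s(2) assms have "\<forall>\<^sub>F y in nhds u. ereal s < f y" by (simp add: lsc_fun_iff)
    then obtain S where S: "open S" "u \<in> S" "\<forall>y\<in>S. ereal s < f y"
      by (auto simp: eventually_nhds)
    have "open (S \<times> {..<s})" "(u, r) \<in> S \<times> {..<s}" using S s by (auto intro: open_Times)
    moreover have "S \<times> {..<s} \<subseteq> {(u, r). ereal r < f u}"
      using S(3) by (auto intro: less_trans[of "ereal _" "ereal s"])
    ultimately show "\<exists>T. open T \<and> (u, r) \<in> T \<and> T \<subseteq> {(u, r). ereal r < f u}" by blast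
  qed
  moreover have "{(u, r::real). f u \<le> ereal r} = - {(u, r). ereal r < f u}" by auto
  ultimately show ?thesis by (simp add: closed_def)
qed

text \<open>A supremum of affine functions: one of them exceeds \<open>C\<close> at
  \<open>y\<close>, and by continuity still does so nearby.\<close>

lemma lsc_fun_fenchel_conj:
  assumes "proper_fun g"
  shows "lsc_fun (fenchel_conj g)"
  unfolding lsc_fun_iff
proof (intro allI impI)
  fix y C assume "C < fenchel_conj g y"
  then obtain v where v: "C < ereal (v \<bullet> y) - g v"
    unfolding fenchel_conj_def less_SUP_iff by blast
  then obtain r where r: "g v = ereal r"
    using assms by (cases "g v") (auto simp: proper_fun_def)
  have "((\<lambda>y. ereal (v \<bullet> y - r)) \<longlongrightarrow> ereal (v \<bullet> y - r)) (nhds y)"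
    by (intro tendsto_intros filterlim_ident)
  then have "\<forall>\<^sub>F y' in nhds y. C < ereal (v \<bullet> y' - r)"
    using v r by (intro order_tendstoD(1)) auto
  then show "\<forall>\<^sub>F y' in nhds y. C < fenchel_conj g y'"
  proof eventually_elim
    case (elim y')
    moreover have "ereal (v \<bullet> y' - r) \<le> fenchel_conj g y'"
      unfolding fenchel_conj_def by (rule SUP_upper2[of v]) (auto simp: r)
    ultimately show ?case by (rule less_le_trans)
  qed
qed

text \<open>The epigraph is an intersection of half-spaces, one for each \<open>v\<close> with
  \<open>g v\<close> finite; the other \<open>v\<close> give the whole space.\<close>

lemma convex_fun_fenchel_conj:
  assumes "proper_fun g"
  shows "convex_fun (fenchel_conj g)"
proof -
  have "{(y, r::real). fenchel_conj g y \<le> ereal r}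
      = (\<Inter>v. {(y, r::real). ereal (v \<bullet> y) - g v \<le> ereal r})"
    by (auto simp: fenchel_conj_def SUP_le_iff)
  moreover have "convex {(y, r::real). ereal (v \<bullet> y) - g v \<le> ereal r}" for v
  proof (cases "g v")
    case (real a)
    then have "{(y, r::real). ereal (v \<bullet> y) - g v \<le> ereal r} = {x. (v, - 1) \<bullet> x \<le> a}"
      by (auto simp: algebra_simps)
    then show ?thesis by (simp add: convex_halfspace_le)
  qed (use assms in \<open>auto simp: proper_fun_def case_prod_unfold\<close>)
  ultimately show ?thesis
    unfolding convex_fun_def by (simp add: convex_INT)
qed

text \<open>Finiteness at some point amounts to an affine minorant of \<open>g\<close>, obtained by
  separating the closed epigraph from the point one unit below the graph at
  \<open>x0\<close>.\<close>

lemma proper_fun_fenchel_conj: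
  fixes g :: "'a::euclidean_space \<Rightarrow> ereal"
  assumes g: "proper_fun g" "lsc_fun g" "convex_fun g"
  shows "proper_fun (fenchel_conj g)"
  unfolding proper_fun_def
proof
  obtain x0 where "g x0 \<noteq> \<infinity>" using g(1) by (auto simp: proper_fun_def)
  then obtain r0 where r0: "g x0 = ereal r0"
    using g(1) by (cases "g x0") (auto simp: proper_fun_def)
  show "\<forall>y. fenchel_conj g y \<noteq> - \<infinity>"
  proof
    fix y
    have "ereal (x0 \<bullet> y - r0) \<le> fenchel_conj g y"
      unfolding fenchel_conj_def by (rule SUP_upper2[of x0]) (auto simp: r0)
    then show "fenchel_conj g y \<noteq> - \<infinity>" by auto
  qed
  let ?S = "{(x, r::real). g x \<le> ereal r}"
  have "convex ?S" "closed ?S" "(x0, r0 - 1) \<notin> ?S"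
    using g closed_epigraph r0 by (auto simp: convex_fun_def)
  from separating_hyperplane_closed_point[OF this] obtain w b where
    w: "w \<bullet> (x0, r0 - 1) < b" "\<forall>x\<in>?S. w \<bullet> x > b" by blast
  obtain p q where pq: "w = (p, q)" by (cases w)
  have above: "b < p \<bullet> x + q * r" if "g x \<le> ereal r" for x r
    using w(2) that pq by auto
  \<comment> \<open>The separated point lies directly below a point of the epigraph, so the
    hyperplane is not vertical; its slope \<open>- p / q\<close> is the witness.\<close>
  have "p \<bullet> x0 + q * (r0 - 1) < p \<bullet> x0 + q * r0"
    using w(1) above[of x0 r0] r0 pq by simp
  then have q: "q > 0" by (simp add: algebra_simps)
  have "fenchel_conj g (- (1 / q) *\<^sub>R p) \<le> ereal (- b / q)"
    unfolding fenchel_conj_def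
  proof (rule SUP_least)
    fix v
    show "ereal (v \<bullet> - (1 / q) *\<^sub>R p) - g v \<le> ereal (- b / q)"
    proof (cases "g v")
      case (real a)
      with above[of v a] have "b / q < (p \<bullet> v + q * a) / q"
        using q by (intro divide_strict_right_mono) auto
      then have "b / q < p \<bullet> v / q + a" using q by (simp add: add_divide_distrib)
      then show ?thesis using real by (simp add: inner_commute)
    qed (use g(1) in \<open>auto simp: proper_fun_def\<close>)
  qed
  then show "\<exists>y. fenchel_conj g y \<noteq> \<infinity>" by (metis ereal_infty_less_eq(1) PInfty_neq_ereal(1))
qed

text \<open>In the finite case the slack is shared equally. The last comparison is not strict
  because \<open>C = - \<infinity>\<close> forces a choice such as
  \<open>c = d = - \<infinity>\<close>.\<close>

lemma ereal_less_add_split: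
  fixes x y :: ereal
  assumes "C < x + y" "x \<noteq> - \<infinity>" "y \<noteq> - \<infinity>"
  obtains c d where "c < x" "d < y" "C \<le> c + d"
proof -
  have "\<exists>c d. c < x \<and> d < y \<and> C \<le> c + d"
  proof (cases C)
    case (real r)
    show ?thesis
    proof (cases x; cases y)
      fix a b assume ab: "x = ereal a" "y = ereal b"
      let ?e = "(a + b - r) / 2"
      have "ereal (a - ?e) < x" "ereal (b - ?e) < y" "C \<le> ereal (a - ?e) + ereal (b - ?e)"
        using assms real ab by (auto simp: field_simps)
      then show ?thesis by blast
    next
      fix a assume ab: "x = ereal a" "y = \<infinity>"
      have "ereal (a - 1) < x" "ereal (r - a + 1) < y" "C \<le> ereal (a - 1) + ereal (r - a + 1)"
        using real ab by auto
      then show ?thesis by blast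
    next
      fix a assume ab: "y = ereal a" "x = \<infinity>"
      have "ereal (r - a + 1) < x" "ereal (a - 1) < y" "C \<le> ereal (r - a + 1) + ereal (a - 1)"
        using real ab by auto
      then show ?thesis by blast
    next
      assume ab: "x = \<infinity>" "y = \<infinity>"
      have "ereal r < x" "ereal 0 < y" "C \<le> ereal r + ereal 0"
        using real ab by auto
      then show ?thesis by blast
    qed (use assms in auto)
  next
    case MInf
    then have "- \<infinity> < x" "- \<infinity> < y" "C \<le> - \<infinity> + - \<infinity>" using assms by auto
    then show ?thesis by blast
  qed (use assms in auto)
  with that show thesis by blast
qed

lemma lsc_fun_separable_sum:
  assumes "lsc_fun f" "lsc_fun h" "\<And>x. f x \<noteq> - \<infinity>" "\<And>y. h y \<noteq> - \<infinity>"
  shows "lsc_fun (\<lambda>z. f (fst z) + h (snd z))"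
  unfolding lsc_fun_iff
proof (intro allI impI)
  fix z C assume "C < f (fst z) + h (snd z)"
  then obtain c d where cd: "c < f (fst z)" "d < h (snd z)" "C \<le> c + d"
    using ereal_less_add_split assms(3,4) by metis
  have fst_snd: "filterlim fst (nhds (fst z)) (nhds z)" "filterlim snd (nhds (snd z)) (nhds z)"
    using tendsto_fst[OF filterlim_ident[of "nhds z"]] tendsto_snd[OF filterlim_ident[of "nhds z"]]
    by simp_all
  have "\<forall>\<^sub>F x in nhds (fst z). c < f x" "\<forall>\<^sub>F y in nhds (snd z). d < h y"
    using assms(1,2) cd by (auto simp: lsc_fun_iff)
  then have "\<forall>\<^sub>F z' in nhds z. c < f (fst z')" "\<forall>\<^sub>F z' in nhds z. d < h (snd z')"
    using fst_snd by (auto intro: eventually_compose_filterlim)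
  then show "\<forall>\<^sub>F z' in nhds z. C < f (fst z') + h (snd z')"
  proof eventually_elim
    case (elim z')
    then have "c + d < f (fst z') + h (snd z')" by (rule ereal_add_strict_mono2)
    with cd(3) show ?case by (rule le_less_trans)
  qed
qed

lemma convex_fun_separable_sum:
  assumes "convex_fun f" "convex_fun h" "\<And>x. f x \<noteq> - \<infinity>" "\<And>y. h y \<noteq> - \<infinity>"
  shows "convex_fun (\<lambda>z. f (fst z) + h (snd z))"
  unfolding convex_fun_def
proof (rule convexI)
  fix Z1 Z2 :: "('a \<times> 'b) \<times> real" and u v :: real
  assume Z: "Z1 \<in> {(z, r). f (fst z) + h (snd z) \<le> ereal r}"
      "Z2 \<in> {(z, r). f (fst z) + h (snd z) \<le> ereal r}"
    and uv: "0 \<le> u" "0 \<le> v" "u + v = 1"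
  obtain x1 y1 r1 x2 y2 r2 where Z_eq: "Z1 = ((x1, y1), r1)" "Z2 = ((x2, y2), r2)"
    by (metis prod.exhaust)
  have le: "f x1 + h y1 \<le> ereal r1" "f x2 + h y2 \<le> ereal r2"
    using Z by (simp_all add: Z_eq)
  obtain a1 where a1: "f x1 = ereal a1" using le assms(3)[of x1] assms(4)[of y1] by (cases "f x1") auto
  obtain b1 where b1: "h y1 = ereal b1" using le assms(3)[of x1] assms(4)[of y1] by (cases "h y1") (auto simp: a1)
  obtain a2 where a2: "f x2 = ereal a2" using le assms(3)[of x2] assms(4)[of y2] by (cases "f x2") auto
  obtain b2 where b2: "h y2 = ereal b2" using le assms(3)[of x2] assms(4)[of y2] by (cases "h y2") (auto simp: a2)
  have 1: "f (u *\<^sub>R x1 + v *\<^sub>R x2) \<le> ereal (u * a1 + v * a2)"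
    using convexD[OF assms(1)[unfolded convex_fun_def], of "(x1, a1)" "(x2, a2)" u v] uv a1 a2 by simp
  have 2: "h (u *\<^sub>R y1 + v *\<^sub>R y2) \<le> ereal (u * b1 + v * b2)"
    using convexD[OF assms(2)[unfolded convex_fun_def], of "(y1, b1)" "(y2, b2)" u v] uv b1 b2 by simp
  have "f (u *\<^sub>R x1 + v *\<^sub>R x2) + h (u *\<^sub>R y1 + v *\<^sub>R y2)
      \<le> ereal (u * a1 + v * a2) + ereal (u * b1 + v * b2)"
    by (rule add_mono[OF 1 2])
  also have "\<dots> = ereal (u * (a1 + b1) + v * (a2 + b2))" by (simp add: algebra_simps)
  also have "\<dots> \<le> ereal (u * r1 + v * r2)"
    using le a1 a2 b1 b2 uv by (simp add: add_mono mult_left_mono)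
  finally show "u *\<^sub>R Z1 + v *\<^sub>R Z2 \<in> {(z, r). f (fst z) + h (snd z) \<le> ereal r}"
    by (simp add: Z_eq)
qed

text \<open>Adding the two saddle inequalities cancels \<open>A xs \<bullet> ys\<close>; what
  remains is the pairing of \<open>skew_op A zs\<close> with \<open>z\<close>.\<close>

lemma saddle_point_minorant:
  fixes f :: "'a::euclidean_space \<Rightarrow> ereal" and g :: "'b::euclidean_space \<Rightarrow> ereal"
  assumes f: "proper_fun f" and g: "proper_fun (fenchel_conj g)"
    and A: "linear A" and zs: "zs \<in> saddle_points f g A"
  shows "\<bar>sum_fun f g zs\<bar> \<noteq> \<infinity>"
    and "sum_fun f g zs + ereal (skew_op A zs \<bullet> z) \<le> sum_fun f g z"
proof -
  let ?h = "fenchel_conj g"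
  obtain xs ys where zs_eq: "zs = (xs, ys)" by (cases zs)
  have sadY: "lagrangian f g A xs y \<le> lagrangian f g A xs ys" for y
    using zs by (auto simp: saddle_points_def zs_eq)
  have sadX: "lagrangian f g A xs ys \<le> lagrangian f g A x ys" for x
    using zs by (auto simp: saddle_points_def zs_eq)
  have f_MInf: "f x \<noteq> - \<infinity>" for x using f by (auto simp: proper_fun_def)
  have h_MInf: "?h y \<noteq> - \<infinity>" for y using g by (auto simp: proper_fun_def)
  obtain x0 where "f x0 \<noteq> \<infinity>" using f by (auto simp: proper_fun_def)
  then obtain a0 where a0: "f x0 = ereal a0" using f_MInf[of x0] by (cases "f x0") auto
  obtain y0 where "?h y0 \<noteq> \<infinity>" using g by (auto simp: proper_fun_def)
  then obtain b0 where b0: "?h y0 = ereal b0" using h_MInf[of y0] by (cases "?h y0") auto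
  \<comment> \<open>The convention \<open>\<infinity> - \<infinity> = \<infinity>\<close> matters
    here: if \<open>f xs = \<infinity>\<close>, the Lagrangian at \<open>(xs, ys)\<close> is
    \<open>\<infinity>\<close> whatever the conjugate is, whereas at \<open>(x0, ys)\<close> it is
    not. Finiteness of the conjugate at \<open>ys\<close> follows only afterwards.\<close>
  obtain a where a: "f xs = ereal a"
  proof (cases "f xs")
    case PInf
    then show ?thesis using sadX[of x0] a0 h_MInf[of ys]
      by (cases "?h ys") (auto simp: lagrangian_def)
  qed (use f_MInf in auto)
  obtain c where c: "?h ys = ereal c"
  proof (cases "?h ys")
    case PInf
    then show ?thesis using sadY[of y0] b0 a by (auto simp: lagrangian_def)
  qed (use h_MInf in auto)
  show "\<bar>sum_fun f g zs\<bar> \<noteq> \<infinity>" by (simp add: sum_fun_def zs_eq a c)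
  obtain x y where z: "z = (x, y)" by (cases z)
  have adj: "adjoint A ys \<bullet> x = A x \<bullet> ys" for x
    using adjoint_works[OF A, of x ys] by (simp add: inner_commute)
  show "sum_fun f g zs + ereal (skew_op A zs \<bullet> z) \<le> sum_fun f g z"
  proof (cases "f x = \<infinity> \<or> ?h y = \<infinity>")
    case True
    then have "sum_fun f g z = \<infinity>" using f_MInf h_MInf by (auto simp: sum_fun_def z)
    then show ?thesis by simp
  next
    case False
    obtain p where p: "f x = ereal p" using False f_MInf[of x] by (cases "f x") auto
    obtain q where q: "?h y = ereal q" using False h_MInf[of y] by (cases "?h y") auto
    show ?thesis
      using sadX[of x] sadY[of y] a c p q
      by (simp add: lagrangian_def sum_fun_def zs_eq z skew_op_def adj)
  qed
qed

section \<open>Norm bounds for the adjoint and for the skew operator\<close>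

lemma norm_adjoint_le:
  fixes A :: "'a::euclidean_space \<Rightarrow> 'b::euclidean_space"
  assumes "linear A"
  shows "norm (adjoint A y) \<le> onorm A * norm y"
proof -
  have bl: "bounded_linear A" using assms by (simp add: linear_conv_bounded_linear)
  have "(norm (adjoint A y))\<^sup>2 = A (adjoint A y) \<bullet> y"
    by (simp add: power2_norm_eq_inner adjoint_works[OF assms])
  also have "\<dots> \<le> norm (A (adjoint A y)) * norm y" by (rule norm_cauchy_schwarz)
  also have "\<dots> \<le> onorm A * norm (adjoint A y) * norm y"
    by (intro mult_right_mono onorm[OF bl]) auto
  finally have "norm (adjoint A y) * norm (adjoint A y) \<le> norm (adjoint A y) * (onorm A * norm y)"
    by (simp add: power2_eq_square algebra_simps)
  then show ?thesis
    using onorm_pos_le[OF bl] by (cases "norm (adjoint A y) = 0") (auto simp: mult_le_cancel_left)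
qed

lemma linear_skew_op:
  fixes A :: "'a::euclidean_space \<Rightarrow> 'b::euclidean_space"
  assumes "linear A"
  shows "linear (skew_op A)"
  by (rule linearI)
    (auto simp: skew_op_def linear_add[OF assms] linear_scale[OF assms]
      linear_add[OF adjoint_linear[OF assms]] linear_scale[OF adjoint_linear[OF assms]])

lemma skew_op_inner_self:
  fixes A :: "'a::euclidean_space \<Rightarrow> 'b::euclidean_space"
  assumes "linear A"
  shows "skew_op A u \<bullet> u = 0"
  using adjoint_works[OF assms, of "fst u" "snd u"]
  by (simp add: skew_op_def inner_prod_def inner_commute)

text \<open>This direction serves \<open>cbar\<close>: having \<open>onorm M\<close> in the
  denominator, it dominates the same quotient formed with \<open>onorm A\<close>.\<close>

lemma onorm_skew_op_le:
  fixes A :: "'a::euclidean_space \<Rightarrow> 'b::euclidean_space"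
  assumes "linear A"
  shows "onorm (skew_op A) \<le> onorm A"
proof (rule onorm_bound)
  have bl: "bounded_linear A" using assms by (simp add: linear_conv_bounded_linear)
  show "0 \<le> onorm A" by (rule onorm_pos_le[OF bl])
  fix u :: "'a \<times> 'b"
  have "(norm (skew_op A u))\<^sup>2 = (norm (adjoint A (snd u)))\<^sup>2 + (norm (A (fst u)))\<^sup>2"
    by (simp add: skew_op_def norm_prod_def)
  also have "\<dots> \<le> (onorm A * norm (snd u))\<^sup>2 + (onorm A * norm (fst u))\<^sup>2"
    by (intro add_mono power_mono norm_adjoint_le[OF assms] onorm[OF bl]) auto
  also have "\<dots> = (onorm A * norm u)\<^sup>2"
    by (simp add: norm_prod_def power_mult_distrib algebra_simps)
  finally show "norm (skew_op A u) \<le> onorm A * norm u"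
    by (rule power2_le_imp_le) (simp add: onorm_pos_le[OF bl])
qed

text \<open>\<open>skew_op\<close> exchanges the two components, hence the crossed weights on the
  right.\<close>

lemma wnorm_sq_skew_op_le:
  fixes A :: "'a::euclidean_space \<Rightarrow> 'b::euclidean_space"
  assumes A: "linear A" and \<beta>: "fst \<beta> > 0" "snd \<beta> > 0"
  shows "wnorm_sq (pair_inverse \<beta>) (skew_op A d)
    \<le> wnorm_sq ((onorm A)\<^sup>2 / snd \<beta>, (onorm A)\<^sup>2 / fst \<beta>) d"
proof -
  have bl: "bounded_linear A" using A by (simp add: linear_conv_bounded_linear)
  have "(norm (adjoint A (snd d)))\<^sup>2 \<le> (onorm A)\<^sup>2 * (norm (snd d))\<^sup>2"
    "(norm (A (fst d)))\<^sup>2 \<le> (onorm A)\<^sup>2 * (norm (fst d))\<^sup>2"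
    using power_mono[OF norm_adjoint_le[OF A], of "snd d" 2] power_mono[OF onorm[OF bl], of "fst d" 2]
    by (simp_all add: power_mult_distrib)
  then have "(norm (adjoint A (snd d)))\<^sup>2 / fst \<beta> \<le> (onorm A)\<^sup>2 * (norm (snd d))\<^sup>2 / fst \<beta>"
    "(norm (A (fst d)))\<^sup>2 / snd \<beta> \<le> (onorm A)\<^sup>2 * (norm (fst d))\<^sup>2 / snd \<beta>"
    using \<beta> by (simp_all add: divide_right_mono)
  then show ?thesis by (simp add: wnorm_sq_def pair_inverse_def skew_op_def)
qed

subsection \<open>Rate of convergence\<close>

text \<open>Both sides are compared with \<open>exp (c / x)\<close>. For \<open>x = k + b\<close>
  the right-hand sides telescope over \<open>k\<close>.\<close>

lemma one_plus_divide_le_powr: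
  fixes c x :: real
  assumes "0 \<le> c" "1 < x"
  shows "1 + c / x \<le> (x / (x - 1)) powr c"
proof -
  have "ln ((x - 1) / x) \<le> (x - 1) / x - 1"
    using assms by (intro ln_le_minus_one) auto
  then have "1 / x \<le> ln (x / (x - 1))"
    using assms by (simp add: ln_div field_simps)
  then have "c / x \<le> c * ln (x / (x - 1))"
    using assms mult_left_mono[of "1 / x" "ln (x / (x - 1))" c] by simp
  have "1 + c / x \<le> exp (c / x)" by (rule exp_ge_add_one_self)
  also have "\<dots> \<le> exp (c * ln (x / (x - 1)))" using \<open>c / x \<le> _\<close> by simp
  also have "\<dots> = (x / (x - 1)) powr c" using assms by (simp add: powr_def)
  finally show ?thesis .
qed

text \<open>The error in \<open>step_E\<close> contains \<open>P k\<close>, which the Lyapunov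
  function in the first conjunct does not control, so a bound for \<open>P\<close> travels along in
  the induction: \<open>step_P\<close> reduces it to the previous \<open>P\<close> and to
  \<open>D\<close>, and \<open>D\<close> is below the Lyapunov function. The index starts after the
  first step, where \<open>\<theta> 0 = 1\<close> has removed the gap and the distance of the
  starting point.\<close>

lemma gap_recursion_bound:
  fixes E D P :: "nat \<Rightarrow> real" and R b t c d :: real
  defines "\<theta> \<equiv> \<lambda>k. t / (real k + t)" and "s \<equiv> \<lambda>k. b / (real k + b)"
    and "\<epsilon> \<equiv> \<lambda>k. c * (b / (real k + b))\<^sup>2"
  assumes t: "2 \<le> t" "t \<le> b" and c: "0 < c" "c * b\<^sup>2 \<le> d * t" and d: "0 \<le> d"
    and E: "\<And>k. 1 \<le> k \<Longrightarrow> 0 \<le> E k" and D: "\<And>k. 0 \<le> D k" and P: "\<And>k. 0 \<le> P k"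
    and base: "2 * s 1 * E 1 + (1 + 2 * \<epsilon> 0) * D 1 \<le> R" "P 1 \<le> D 1"
    and step_E: "\<And>k. 1 \<le> k \<Longrightarrow> s (Suc k) * E (Suc k) \<le> (1 - \<theta> k) * (s k * E k)
        + (\<theta> k)\<^sup>2 / 2 * ((1 + 3 * \<epsilon> k) * D k - (1 + 2 * \<epsilon> k) * D (Suc k))
        + \<theta> k * (1 - \<theta> k) / 2 * (\<epsilon> k * P k)"
    and step_P: "\<And>k. P (Suc k) \<le> (1 - \<theta> k) * P k + \<theta> k * D (Suc k)"
  shows "2 * (s (Suc j) * E (Suc j)) / (\<theta> j)\<^sup>2 + (1 + 2 * \<epsilon> j) * D (Suc j)
      \<le> R * ((real j + b) / b) powr d \<and> P (Suc j) \<le> R * ((real j + b) / b) powr d"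
proof (induction j)
  case 0
  have "0 \<le> \<epsilon> 0" using c by (simp add: \<epsilon>_def)
  then have "D 1 \<le> (1 + 2 * \<epsilon> 0) * D 1" using D[of 1] by (simp add: algebra_simps)
  moreover have "0 \<le> 2 * s 1 * E 1" using E[of 1] t by (simp add: s_def)
  moreover have "\<theta> 0 = 1" using t by (simp add: \<theta>_def)
  moreover have "P 1 \<le> R"
    using base calculation(1,2) by linarith
  ultimately show ?case using base t by simp
next
  case (Suc j)
  define k where "k = Suc j"
  define S where "S = (\<lambda>j. 2 * (s (Suc j) * E (Suc j)) / (\<theta> j)\<^sup>2 + (1 + 2 * \<epsilon> j) * D (Suc j))"
  define R' where "R' = R * ((real j + b) / b) powr d"
  have IH: "S j \<le> R'" "P k \<le> R'" using Suc by (simp_all add: S_def R'_def k_def)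
  have \<epsilon>: "0 \<le> \<epsilon> k" "0 \<le> \<epsilon> j" using c by (simp_all add: \<epsilon>_def)
  have \<epsilon>_mono: "\<epsilon> k \<le> \<epsilon> j"
    unfolding \<epsilon>_def k_def using t c by (intro mult_left_mono power_mono frac_le) auto
  have \<theta>: "0 < \<theta> k" "\<theta> k \<le> 1" "0 < \<theta> j" using t by (simp_all add: \<theta>_def k_def)
  have sE: "0 \<le> s k * E k" using E[of k] t by (simp add: s_def k_def)
  have DS: "D k \<le> S j"
  proof -
    have "0 \<le> 2 * (s k * E k) / (\<theta> j)\<^sup>2" using sE by simp
    moreover have "D k \<le> (1 + 2 * \<epsilon> j) * D k"
      using \<epsilon> D[of k] by (simp add: algebra_simps)
    ultimately show ?thesis by (simp add: S_def k_def)
  qed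
  have "S k * (\<theta> k)\<^sup>2 = 2 * (s (Suc k) * E (Suc k)) + (\<theta> k)\<^sup>2 * ((1 + 2 * \<epsilon> k) * D (Suc k))"
    using \<theta> by (simp add: S_def field_simps)
  also have "\<dots> \<le> 2 * ((1 - \<theta> k) * (s k * E k))
      + (\<theta> k)\<^sup>2 * ((1 + 3 * \<epsilon> k) * D k) + \<theta> k * (1 - \<theta> k) * (\<epsilon> k * P k)"
    using step_E[of k]
    by (simp add: k_def algebra_simps add_divide_distrib diff_divide_distrib power2_eq_square)
  \<comment> \<open>Factoring out the square of \<open>\<theta> k\<close> rests on three facts:
    \<open>1 - \<theta> k\<close> is at most the square of \<open>\<theta> k / \<theta> j\<close>,
    \<open>3 * \<epsilon> k \<le> 2 * \<epsilon> j + \<epsilon> k\<close>, and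
    \<open>1 - \<theta> k = \<theta> k * k / t\<close>.\<close>
  also have "\<dots> \<le> (\<theta> k)\<^sup>2 * (2 * (s k * E k) / (\<theta> j)\<^sup>2
      + (1 + 2 * \<epsilon> j + \<epsilon> k) * D k + k / t * \<epsilon> k * P k)"
  proof -
    have "2 * t \<le> t * t" "2 * real j \<le> t * real j"
      using t by (intro mult_right_mono; simp)+
    \<comment> \<open>Here \<open>t \<ge> 2\<close> enters: it makes each bracket on the right
      nonnegative.\<close>
    moreover have "(real j + t)\<^sup>2 - (real j + 1) * (real j + 1 + t)
        = (t * t - 2 * t) + (t * real j - 2 * real j) + (t - 1)"
      by (simp add: power2_eq_square algebra_simps)
    ultimately have "(real j + 1) * (real j + 1 + t) \<le> (real j + t)\<^sup>2"
      using t by linarith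
    then have "(real j + 1) * (real j + 1 + t) / (real k + t)\<^sup>2 \<le> (real j + t)\<^sup>2 / (real k + t)\<^sup>2"
      by (rule divide_right_mono) simp
    moreover have "1 - \<theta> k = (real j + 1) * (real j + 1 + t) / (real k + t)\<^sup>2"
      using t by (simp add: \<theta>_def k_def divide_simps power2_eq_square add.commute)
    moreover have "(\<theta> k)\<^sup>2 / (\<theta> j)\<^sup>2 = (real j + t)\<^sup>2 / (real k + t)\<^sup>2"
      using t by (simp add: \<theta>_def power_divide)
    ultimately have "1 - \<theta> k \<le> (\<theta> k)\<^sup>2 / (\<theta> j)\<^sup>2" by simp
    then have "(1 - \<theta> k) * (s k * E k) \<le> (\<theta> k)\<^sup>2 / (\<theta> j)\<^sup>2 * (s k * E k)"
      using sE by (rule mult_right_mono)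
    moreover have "(\<theta> k)\<^sup>2 * ((1 + 3 * \<epsilon> k) * D k) \<le> (\<theta> k)\<^sup>2 * ((1 + 2 * \<epsilon> j + \<epsilon> k) * D k)"
      using \<epsilon>_mono D by (intro mult_left_mono mult_right_mono) auto
    moreover have "\<theta> k * (1 - \<theta> k) * (\<epsilon> k * P k) = (\<theta> k)\<^sup>2 * (k / t * \<epsilon> k * P k)"
    proof -
      have "\<theta> k * (1 - \<theta> k) = (\<theta> k)\<^sup>2 * (k / t)"
        using t by (simp add: \<theta>_def field_simps power2_eq_square)
      then show ?thesis by simp
    qed
    moreover have "(\<theta> k)\<^sup>2 * (2 * (s k * E k) / (\<theta> j)\<^sup>2 + u + v)
        = 2 * ((\<theta> k)\<^sup>2 / (\<theta> j)\<^sup>2 * (s k * E k)) + (\<theta> k)\<^sup>2 * u + (\<theta> k)\<^sup>2 * v" for u v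
      by (simp add: algebra_simps)
    ultimately show ?thesis by simp
  qed
  also have "\<dots> = (\<theta> k)\<^sup>2 * (S j + \<epsilon> k * D k + k / t * \<epsilon> k * P k)"
    by (simp add: S_def k_def algebra_simps)
  also have "\<dots> \<le> (\<theta> k)\<^sup>2 * (R' + \<epsilon> k * R' + k / t * \<epsilon> k * R')"
    using IH DS \<epsilon> t by (intro mult_left_mono add_mono) auto
  finally have "S k \<le> R' + \<epsilon> k * R' + k / t * \<epsilon> k * R'"
    using \<theta> by (simp add: mult.commute)
  also have "\<dots> = R' * (1 + \<epsilon> k * (1 + k / t))" by (simp add: algebra_simps)
  also have "\<dots> \<le> R' * ((real k + b) / (real j + b)) powr d"
  proof (rule mult_left_mono)
    \<comment> \<open>The bound on \<open>c\<close> cancels \<open>t\<close>, and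
      \<open>t \<le> b\<close> turns \<open>t + k\<close> into \<open>k + b\<close>, leaving
      \<open>d / (k + b)\<close>. Since \<open>k + b - 1 = j + b\<close>, the resulting power
      continues that of the induction hypothesis.\<close>
    have "\<epsilon> k * (1 + k / t) = c * b\<^sup>2 * (t + k) / (t * (real k + b)\<^sup>2)"
      using t by (simp add: \<epsilon>_def power_divide field_simps)
    also have "\<dots> \<le> d * t * (real k + b) / (t * (real k + b)\<^sup>2)"
      using c t d by (intro divide_right_mono mult_mono[OF c(2)]) auto
    also have "\<dots> = d / (real k + b)"
      using t by (simp add: power2_eq_square)
    finally have "1 + \<epsilon> k * (1 + k / t) \<le> 1 + d / (real k + b)" by simp
    also have "\<dots> \<le> ((real k + b) / (real k + b - 1)) powr d"
      using d t by (intro one_plus_divide_le_powr) auto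
    finally show "1 + \<epsilon> k * (1 + k / t) \<le> ((real k + b) / (real j + b)) powr d"
      by (simp add: k_def algebra_simps)
    show "0 \<le> R'" using IH(2) P[of k] by linarith
  qed
  also have "\<dots> = R * ((real k + b) / b) powr d"
    using t by (simp add: R'_def mult.assoc flip: powr_mult)
  finally have Sk: "S k \<le> R * ((real k + b) / b) powr d" .
  have "P (Suc k) \<le> R * ((real k + b) / b) powr d"
  proof -
    let ?U = "R * ((real k + b) / b) powr d"
    have "0 \<le> R' " using IH(2) P[of k] by linarith
    then have "0 \<le> R" using t by (simp add: R'_def zero_le_mult_iff)
    then have "R' \<le> ?U" unfolding R'_def using t d
      by (intro mult_left_mono powr_mono2 divide_right_mono) (auto simp: k_def)
    then have "P k \<le> ?U" using IH(2) by simp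
    moreover have "D (Suc k) \<le> ?U"
    proof -
      have "0 \<le> 2 * (s (Suc k) * E (Suc k)) / (\<theta> k)\<^sup>2" using E[of "Suc k"] t by (simp add: s_def)
      moreover have "D (Suc k) \<le> (1 + 2 * \<epsilon> k) * D (Suc k)"
        using \<epsilon> D[of "Suc k"] by (simp add: algebra_simps)
      ultimately show ?thesis using Sk by (simp add: S_def)
    qed
    ultimately have "(1 - \<theta> k) * P k + \<theta> k * D (Suc k) \<le> (1 - \<theta> k) * ?U + \<theta> k * ?U"
      using \<theta> by (intro add_mono mult_left_mono) auto
    then show ?thesis using step_P[of k] by (simp add: algebra_simps)
  qed
  with Sk show ?case by (simp add: S_def k_def)
qed

text \<open>For \<open>x = K + b - 2\<close>, the first power is at most \<open>x powr d\<close>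
  because \<open>b \<ge> 2\<close>, and the remaining factor is at most
  \<open>b / 2 * (1 / x)\<close>.\<close>

lemma rate_constant_le:
  fixes K b t d :: real
  assumes K: "1 \<le> K" and t: "2 \<le> t" "t \<le> b" and d: "0 \<le> d"
  shows "((K - 1 + b) / b) powr d * (t / (K - 1 + t))\<^sup>2 / (2 * (b / (K + b)))
    \<le> b / 2 * (1 / (K + b - 2) powr (1 - d))"
proof -
  define x where "x = K + b - 2"
  have x: "1 \<le> x" using K t by (simp add: x_def)
  have "K - 1 + b \<le> b * x"
  proof -
    have "1 * (K - 1) \<le> b * (K - 1)" "2 * b \<le> b * b"
      using K t by (intro mult_right_mono; simp)+
    then show ?thesis by (simp add: x_def algebra_simps)
  qed
  then have 1: "((K - 1 + b) / b) powr d \<le> x powr d"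
    using K t d by (intro powr_mono2) (auto simp: field_simps)
  have "t * (K - 1 + b) \<le> b * (K - 1 + t)"
    using mult_right_mono[of t b "K - 1"] K t by (simp add: algebra_simps)
  then have "(t * (K - 1 + b))\<^sup>2 \<le> (b * (K - 1 + t))\<^sup>2"
    using K t by (intro power_mono) auto
  \<comment> \<open>The shift by 2 in the rate fits this estimate: \<open>K + b\<close> and
    \<open>K + b - 2\<close> are the neighbours of \<open>K + b - 1\<close>, so their product is its
    square minus 1.\<close>
  moreover have "(K + b) * x \<le> (K - 1 + b)\<^sup>2"
    by (simp add: x_def power2_eq_square algebra_simps)
  then have "t\<^sup>2 * ((K + b) * x) \<le> t\<^sup>2 * (K - 1 + b)\<^sup>2" by (intro mult_left_mono) auto
  ultimately have "t\<^sup>2 * (K + b) * x \<le> b\<^sup>2 * (K - 1 + t)\<^sup>2"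
    by (simp add: power_mult_distrib)
  moreover define q where "q = K - 1 + t"
  moreover have q: "q > 0" using K t by (simp add: q_def)
  ultimately have "t\<^sup>2 * (K + b) * x / (2 * b * q\<^sup>2 * x) \<le> b\<^sup>2 * q\<^sup>2 / (2 * b * q\<^sup>2 * x)"
    using t x by (intro divide_right_mono) auto
  moreover have "t\<^sup>2 * (K + b) * x / (2 * b * q\<^sup>2 * x) = (t / q)\<^sup>2 / (2 * (b / (K + b)))"
    using K t x q by (simp add: power_divide)
  moreover have "b\<^sup>2 * q\<^sup>2 / (2 * b * q\<^sup>2 * x) = b / 2 * (1 / x)"
    using t x q by (simp add: power2_eq_square)
  ultimately have 2: "(t / (K - 1 + t))\<^sup>2 / (2 * (b / (K + b))) \<le> b / 2 * (1 / x)"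
    by (simp add: q_def)
  have "((K - 1 + b) / b) powr d * ((t / (K - 1 + t))\<^sup>2 / (2 * (b / (K + b))))
      \<le> x powr d * (b / 2 * (1 / x))"
    using 1 2 K t by (intro mult_mono) auto
  also have "\<dots> = b / 2 * (1 / x powr (1 - d))"
    using x by (simp add: powr_diff)
  finally show ?thesis by (simp add: x_def)
qed

section \<open>The convergence rate of the scheme\<close>

theorem theorem2:
  fixes f :: "real ^ 'n \<Rightarrow> ereal" and g :: "real ^ 'm \<Rightarrow> ereal"
    and A :: "real ^ 'n \<Rightarrow> real ^ 'm"
    and M :: "(real ^ 'n) \<times> (real ^ 'm) \<Rightarrow> (real ^ 'n) \<times> (real ^ 'm)"
    and F :: "(real ^ 'n) \<times> (real ^ 'm) \<Rightarrow> ereal"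
    and \<beta>0 :: "real \<times> real" and b t cbar :: real
    and \<theta> :: "nat \<Rightarrow> real" and \<beta> \<gamma> :: "nat \<Rightarrow> real \<times> real"
    and z zbar zhat :: "nat \<Rightarrow> (real ^ 'n) \<times> (real ^ 'm)"
  assumes f: "proper_fun f" "lsc_fun f" "convex_fun f"
    and g: "proper_fun g" "lsc_fun g" "convex_fun g"
    and A: "linear A" "A \<noteq> (\<lambda>x. 0)"
    and saddle: "saddle_points f g A \<noteq> {}"
    and M: "M = skew_op A"
    and F: "F = sum_fun f g"
    and \<beta>0: "fst \<beta>0 > 0" "snd \<beta>0 > 0"
    and \<theta>: "\<And>k. \<theta> k = t / (real k + t)"
    and \<beta>: "\<And>k. \<beta> k = (b / (real k + b)) *\<^sub>R \<beta>0"
    and \<gamma>: "\<And>k. \<gamma> k =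
          (snd (\<beta> k) / (2 * fst (\<beta> k) * snd (\<beta> k) + (onorm A)\<^sup>2),
           fst (\<beta> k) / (2 * snd (\<beta> k) * fst (\<beta> k) + (onorm A)\<^sup>2))"
    and bt: "b \<ge> t" "t \<ge> 2"
    and cbar: "cbar = fst \<beta>0 * snd \<beta>0 * b\<^sup>2 / (t * (onorm M)\<^sup>2)" "cbar < 1"
    and init: "zbar 0 = z 0"
    and zhat: "\<And>k. zhat k = (1 - \<theta> k) *\<^sub>R z k + \<theta> k *\<^sub>R zbar k"
    and zbar: "\<And>k. zbar (Suc k) =
          prox ((1 / \<theta> k) *\<^sub>R \<gamma> k) F
            (zbar k - pair_scale ((1 / \<theta> k) *\<^sub>R \<gamma> k) (grad_smoothed_conj (\<beta> k) M F (zhat k)))"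
    and z: "\<And>k. z (Suc k) = (1 - \<theta> k) *\<^sub>R z k + \<theta> k *\<^sub>R zbar (Suc k)"
  shows "\<forall>zstar \<in> saddle_points f g A.
      (\<forall>K\<ge>1. smoothed_gap (\<beta> K) M F (z K)
          \<le> ereal (b / 2 * (1 / (real K + b - 2) powr (1 - cbar))
                    * wnorm_sq (pair_inverse (\<gamma> 0) + \<beta> 0) (z 0 - zstar))) \<and>
      (\<lambda>K::nat. b / 2 * (1 / (real K + b - 2) powr (1 - cbar))
                    * wnorm_sq (pair_inverse (\<gamma> 0) + \<beta> 0) (z 0 - zstar))
        \<in> O(\<lambda>K. real K powr (cbar - 1))"
proof (intro ballI conjI allI impI)
  fix zstar assume zstar: "zstar \<in> saddle_points f g A"
  have conj: "proper_fun (fenchel_conj g)" by (rule proper_fun_fenchel_conj[OF g])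
  have F_eq: "F = (\<lambda>z. f (fst z) + fenchel_conj g (snd z))"
    by (rule ext) (simp add: F sum_fun_def)
  have not_MInf: "f x \<noteq> - \<infinity>" "fenchel_conj g y \<noteq> - \<infinity>" for x y
    using f(1) conj by (auto simp: proper_fun_def)
  interpret skew_gap F M zstar
  proof (rule skew_gap.intro)
    show "linear M" unfolding M by (rule linear_skew_op[OF A(1)])
    show "M u \<bullet> u = 0" for u unfolding M by (rule skew_op_inner_self[OF A(1)])
    have "lsc_fun F"
      unfolding F_eq by (rule lsc_fun_separable_sum[OF f(2) lsc_fun_fenchel_conj[OF g(1)] not_MInf])
    then show "closed {(u, r). F u \<le> ereal r}" by (rule closed_epigraph)
    have "convex_fun F"
      unfolding F_eq
      by (rule convex_fun_separable_sum[OF f(3) convex_fun_fenchel_conj[OF g(1)] not_MInf])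
    then show "convex {(u, r). F u \<le> ereal r}" by (simp add: convex_fun_def)
    show "\<bar>F zstar\<bar> \<noteq> \<infinity>"
      unfolding F by (rule saddle_point_minorant(1)[OF f(1) conj A(1) zstar])
    show "F zstar + ereal (M zstar \<bullet> u) \<le> F u" for u
      unfolding F M by (rule saddle_point_minorant(2)[OF f(1) conj A(1) zstar])
  qed
  define L where "L = onorm A"
  have bl: "bounded_linear A" using A(1) by (simp add: linear_conv_bounded_linear)
  have L: "L > 0" using A(2) onorm_pos_lt[OF bl] by (auto simp: L_def fun_eq_iff)
  have b: "b > 0" and t: "t > 0" using bt by auto
  define s where "s k = b / (real k + b)" for k :: nat
  have s: "s k > 0" for k using b by (simp add: s_def)
  define N where "N = (L\<^sup>2 / snd \<beta>0, L\<^sup>2 / fst \<beta>0)"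
  define c where "c = fst \<beta>0 * snd \<beta>0 / L\<^sup>2"
  have c: "c > 0" using \<beta>0 L by (simp add: c_def)
  define \<epsilon> where "\<epsilon> k = c * (s k)\<^sup>2" for k :: nat
  have \<beta>_pos: "fst (\<beta> k) > 0" "snd (\<beta> k) > 0" for k
    using \<beta>0 b by (simp_all add: \<beta>)
  have \<gamma>_pos: "fst (\<gamma> k) > 0" "snd (\<gamma> k) > 0" for k
    unfolding \<gamma> using \<beta>_pos[of k] by (simp_all add: add_pos_nonneg)
  have \<beta>_s: "\<beta> k = s k *\<^sub>R \<beta>0" for k by (simp add: \<beta> s_def)
  have \<beta>_N: "\<beta> k = (\<epsilon> k / s k) *\<^sub>R N" for k
    using \<beta>0 L s[of k]
    by (simp add: \<beta>_s \<epsilon>_def N_def c_def prod_eq_iff power2_eq_square)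
  have \<gamma>_N: "pair_inverse (\<gamma> k) = ((1 + 2 * \<epsilon> k) / s k) *\<^sub>R N" for k
    using \<beta>0 L s[of k]
    by (simp add: \<gamma> pair_inverse_def \<beta>_s L_def[symmetric] \<epsilon>_def N_def c_def
        prod_eq_iff field_simps power2_eq_square)
  have sum_N: "pair_inverse (\<gamma> k) + \<beta> k = ((1 + 3 * \<epsilon> k) / s k) *\<^sub>R N" for k
    by (simp add: \<gamma>_N \<beta>_N add_divide_distrib flip: scaleR_add_left)
  have N_nonneg: "0 \<le> wnorm_sq N u" for u :: "(real ^ 'n) \<times> (real ^ 'm)"
    using \<beta>0 by (intro wnorm_sq_nonneg) (simp_all add: N_def)
  have smooth: "wnorm_sq (pair_inverse (\<beta> k)) (M d) \<le> wnorm_sq (pair_inverse (\<gamma> k)) d" for k d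
  proof -
    have "wnorm_sq (pair_inverse (\<beta> k)) (M d)
        \<le> wnorm_sq ((onorm A)\<^sup>2 / snd (\<beta> k), (onorm A)\<^sup>2 / fst (\<beta> k)) d"
      unfolding M by (rule wnorm_sq_skew_op_le[OF A(1) \<beta>_pos])
    also have "((onorm A)\<^sup>2 / snd (\<beta> k), (onorm A)\<^sup>2 / fst (\<beta> k)) = (1 / s k) *\<^sub>R N"
      by (simp add: \<beta>_s N_def L_def)
    \<comment> \<open>The step size leaves the surplus \<open>2 * \<epsilon> k\<close> over what the
      curvature bound asks for.\<close>
    also have "wnorm_sq \<dots> d \<le> wnorm_sq (pair_inverse (\<gamma> k)) d"
      unfolding \<gamma>_N wnorm_sq_weight_scaleR using s[of k] c N_nonneg[of d]
      by (intro mult_right_mono divide_right_mono) (auto simp: \<epsilon>_def)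
    finally show ?thesis .
  qed
  have \<theta>_range: "0 < \<theta> k" "\<theta> k \<le> 1" for k using t by (simp_all add: \<theta>)
  have \<theta>0: "\<theta> 0 = 1" using t by (simp add: \<theta>)
  \<comment> \<open>\<open>F (z 0)\<close> may be infinite; \<open>\<theta> 0 = 1\<close> discards
    \<open>z 0\<close>, and convexity keeps the later iterates in the domain.\<close>
  have F_fin: "F (z (Suc k)) \<noteq> \<infinity>" for k
  proof (induction k)
    case 0
    show ?case
      by (rule accelerated_step(1)[OF \<beta>_pos \<gamma>_pos smooth \<theta>_range _ zhat zbar z]) (simp add: \<theta>0)
  next
    case (Suc k)
    then show ?case
      by (intro accelerated_step(1)[OF \<beta>_pos \<gamma>_pos smooth \<theta>_range _ zhat zbar z]) simp
  qed
  define E where "E k = gap_real (\<beta> k) (z k)" for k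
  define D where "D k = wnorm_sq N (zbar k - zstar)" for k
  define P where "P k = wnorm_sq N (z k - zstar)" for k
  have fin_or: "\<theta> k = 1 \<or> F (z k) \<noteq> \<infinity>" for k
    using F_fin \<theta>0 by (cases k) auto
  have step: "s (Suc k) * E (Suc k) \<le> (1 - \<theta> k) * (s k * E k)
        + (\<theta> k)\<^sup>2 / 2 * ((1 + 3 * \<epsilon> k) * D k - (1 + 2 * \<epsilon> k) * D (Suc k))
        + \<theta> k * (1 - \<theta> k) / 2 * (\<epsilon> k * P k)" for k
  proof -
    have "gap_real (\<beta> k) (z (Suc k)) \<le> (1 - \<theta> k) * E k
      + (\<theta> k)\<^sup>2 / 2 * ((1 + 3 * \<epsilon> k) / s k * D k - (1 + 2 * \<epsilon> k) / s k * D (Suc k))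
      + \<theta> k * (1 - \<theta> k) / 2 * (\<epsilon> k / s k * P k)"
      using accelerated_step(2)[OF \<beta>_pos \<gamma>_pos smooth \<theta>_range fin_or zhat zbar z, of k]
      unfolding sum_N unfolding \<gamma>_N
      by (simp only: wnorm_sq_weight_scaleR E_def D_def P_def
          \<beta>_N[of k, THEN arg_cong[where f = "\<lambda>\<beta>. wnorm_sq \<beta> (z k - zstar)"]])
    then have "s k * gap_real (\<beta> k) (z (Suc k)) \<le> s k * ((1 - \<theta> k) * E k
      + (\<theta> k)\<^sup>2 / 2 * ((1 + 3 * \<epsilon> k) / s k * D k - (1 + 2 * \<epsilon> k) / s k * D (Suc k))
      + \<theta> k * (1 - \<theta> k) / 2 * (\<epsilon> k / s k * P k))"
      using s[of k] by (intro mult_left_mono) auto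
    also have "\<dots> = (1 - \<theta> k) * (s k * E k)
        + (\<theta> k)\<^sup>2 / 2 * ((1 + 3 * \<epsilon> k) * D k - (1 + 2 * \<epsilon> k) * D (Suc k))
        + \<theta> k * (1 - \<theta> k) / 2 * (\<epsilon> k * P k)"
    proof -
      have "\<sigma> * (p * e + q * (u / \<sigma> * v - u' / \<sigma> * v') + r * (w / \<sigma> * v''))
          = p * (\<sigma> * e) + q * (u * v - u' * v') + r * (w * v'')"
        if "\<sigma> \<noteq> 0" for \<sigma> p e q u v u' v' r w v'' :: real
        using that by (simp add: algebra_simps)
      moreover have "s k \<noteq> 0" using s[of k] by simp
      ultimately show ?thesis .
    qed
    finally have 1: "s k * gap_real (\<beta> k) (z (Suc k)) \<le> \<dots>" .
    \<comment> \<open>The factor lost when the smoothing weight shrinks is the ratio that turns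
      \<open>s k\<close> into \<open>s (Suc k)\<close>.\<close>
    define \<rho> where "\<rho> = s (Suc k) / s k"
    have \<rho>: "0 < \<rho>" "\<rho> \<le> 1"
      using s b by (simp_all add: \<rho>_def) (simp add: s_def frac_le)
    have "\<beta> (Suc k) = \<rho> *\<^sub>R \<beta> k"
      using s[of k] by (simp add: \<beta> \<rho>_def s_def[symmetric] del: of_nat_Suc)
    then have "\<rho> * E (Suc k) \<le> gap_real (\<beta> k) (z (Suc k))"
      using gap_real_scaleR_le[OF \<beta>_pos F_fin \<rho>, of k k] by (simp add: E_def)
    then have "s k * (\<rho> * E (Suc k)) \<le> s k * gap_real (\<beta> k) (z (Suc k))"
      using s[of k] by (intro mult_left_mono) auto
    with 1 show ?thesis using s[of k] by (simp add: \<rho>_def)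
  qed
  have step_P: "P (Suc k) \<le> (1 - \<theta> k) * P k + \<theta> k * D (Suc k)" for k
  proof -
    have "z (Suc k) - zstar = (1 - \<theta> k) *\<^sub>R (z k - zstar) + \<theta> k *\<^sub>R (zbar (Suc k) - zstar)"
      by (simp add: z algebra_simps)
    moreover have "0 \<le> \<theta> k * (1 - \<theta> k) * wnorm_sq N (z k - zstar - (zbar (Suc k) - zstar))"
      using \<theta>_range[of k] N_nonneg by simp
    ultimately show ?thesis by (simp add: P_def D_def wnorm_sq_convex_comb)
  qed
  define W where "W = wnorm_sq (pair_inverse (\<gamma> 0) + \<beta> 0) (z 0 - zstar)"
  have s0: "s 0 = 1" using b by (simp add: s_def)
  have W: "W = (1 + 3 * \<epsilon> 0) * D 0"
    by (simp add: W_def sum_N wnorm_sq_weight_scaleR D_def init s0)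
  \<comment> \<open>At \<open>k = 0\<close> the recursion loses its gap and \<open>P\<close> terms,
    and its remaining positive term is half of \<open>W\<close>.\<close>
  have base: "2 * s 1 * E 1 + (1 + 2 * \<epsilon> 0) * D 1 \<le> W" "P 1 \<le> D 1"
    using step[of 0] step_P[of 0] by (simp_all add: \<theta>0 W)
  have "onorm M > 0"
  proof -
    have "bounded_linear M" using lin by (simp add: linear_conv_bounded_linear)
    moreover obtain x where "A x \<noteq> 0" using A(2) by auto
    then have "M (x, 0) \<noteq> 0" by (simp add: M skew_op_def prod_eq_iff)
    ultimately show ?thesis using onorm_pos_lt by metis
  qed
  moreover have "onorm M \<le> L" unfolding M L_def by (rule onorm_skew_op_le[OF A(1)])
  ultimately have "fst \<beta>0 * snd \<beta>0 * b\<^sup>2 / (t * L\<^sup>2) \<le> cbar"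
    unfolding cbar(1) using \<beta>0 t L
    by (intro divide_left_mono mult_left_mono power_mono) auto
  then have c_cbar: "c * b\<^sup>2 \<le> cbar * t" using t L by (simp add: c_def field_simps)
  have cbar_nonneg: "0 \<le> cbar" using cbar(1) \<beta>0 t by simp
  \<comment> \<open>Stated from index 1 on, where \<open>F\<close> is known to be finite.\<close>
  have E_nonneg: "0 \<le> E k" if "1 \<le> k" for k
    using gap_real_nonneg[OF \<beta>_pos F_fin, of k "k - 1"] that by (simp add: E_def)
  have D_nonneg: "0 \<le> D k" and P_nonneg: "0 \<le> P k" for k
    by (simp_all add: D_def P_def N_nonneg)
  fix K :: nat assume K: "1 \<le> K"
  then obtain j where j: "K = Suc j" by (cases K) auto
  have "2 * (s (Suc j) * E (Suc j)) / (\<theta> j)\<^sup>2 + (1 + 2 * \<epsilon> j) * D (Suc j)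
      \<le> W * ((real j + b) / b) powr cbar"
    using gap_recursion_bound[OF bt(2,1) c c_cbar cbar_nonneg E_nonneg D_nonneg P_nonneg,
        folded \<theta> s_def, folded \<epsilon>_def, OF _ base step step_P]
    by blast
  moreover have "0 \<le> (1 + 2 * \<epsilon> j) * D (Suc j)"
    using D_nonneg[of "Suc j"] c by (simp add: \<epsilon>_def)
  ultimately have "2 * (s K * E K) / (\<theta> j)\<^sup>2 \<le> W * ((real j + b) / b) powr cbar"
    by (simp add: j)
  then have "E K \<le> ((real j + b) / b) powr cbar * (\<theta> j)\<^sup>2 / (2 * s K) * W"
    using s[of K] \<theta>_range[of j] by (simp add: field_simps)
  also have "\<dots> \<le> b / 2 * (1 / (real K + b - 2) powr (1 - cbar)) * W"
  proof (rule mult_right_mono)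
    show "((real j + b) / b) powr cbar * (\<theta> j)\<^sup>2 / (2 * s K)
        \<le> b / 2 * (1 / (real K + b - 2) powr (1 - cbar))"
      using rate_constant_le[of "real K", OF _ bt(2,1) cbar_nonneg] by (simp add: j \<theta> s_def)
    show "0 \<le> W" using D_nonneg[of 0] c by (simp add: W \<epsilon>_def)
  qed
  finally show "smoothed_gap (\<beta> K) M F (z K)
      \<le> ereal (b / 2 * (1 / (real K + b - 2) powr (1 - cbar))
            * wnorm_sq (pair_inverse (\<gamma> 0) + \<beta> 0) (z 0 - zstar))"
    using smoothed_gap_eq_gap_real[OF \<beta>_pos F_fin, of K j] by (simp add: E_def W_def j)
next
  fix zstar
  let ?W = "wnorm_sq (pair_inverse (\<gamma> 0) + \<beta> 0) (z 0 - zstar)"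
  show "(\<lambda>K::nat. b / 2 * (1 / (real K + b - 2) powr (1 - cbar)) * ?W)
      \<in> O(\<lambda>K. real K powr (cbar - 1))"
  proof (rule bigoI[of _ "\<bar>b / 2 * ?W\<bar>"], rule eventually_sequentiallyI[of 1])
    fix K :: nat assume K: "1 \<le> K"
    have "1 / (real K + b - 2) powr (1 - cbar) = (real K + b - 2) powr (cbar - 1)"
      using powr_minus_divide[of "real K + b - 2" "1 - cbar"] by simp
    \<comment> \<open>\<open>b \<ge> 2\<close> gives \<open>K + b - 2 \<ge> K\<close>, and the
      exponent is negative.\<close>
    also have "\<dots> \<le> real K powr (cbar - 1)"
      using K bt cbar(2) by (intro powr_mono2') auto
    finally have "\<bar>1 / (real K + b - 2) powr (1 - cbar)\<bar> \<le> \<bar>real K powr (cbar - 1)\<bar>"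
      by simp
    then have "\<bar>b / 2 * ?W\<bar> * \<bar>1 / (real K + b - 2) powr (1 - cbar)\<bar>
        \<le> \<bar>b / 2 * ?W\<bar> * \<bar>real K powr (cbar - 1)\<bar>"
      by (rule mult_left_mono) simp
    then show "norm (b / 2 * (1 / (real K + b - 2) powr (1 - cbar)) * ?W)
        \<le> \<bar>b / 2 * ?W\<bar> * norm (real K powr (cbar - 1))"
      by (simp add: abs_mult mult.commute mult.left_commute)
  qed
qed

end
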